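(* Let $n\geq 1$ and let $(X_0,X_1,\dotsc,X_n)$ be a discrete-time martingale with respect to a sequence of random variables $(E_1,\dotsc,E_n)$ such that $X_i\in[0,1]$ for all $i\in\{1,\dotsc,n\}$ and $X_n\in\{0,1\}$. Then $$\sup_{\tau}\ \mathbb{E}\big[\,|X_\tau-X_{\tau-1}|\,\big]\ \geq\ C_n(X_0),$$ where the supremum is over all stopping times $\tau$ with values in $\{1,\dotsc,n\}$. Furthermore, for all $n\geq 1$ and $X_0\in[0,1]$, there exists a martingale $(X_0,\dotsc,X_n)$ with respect to the coordinate-exposure filtration of $\{0,1\}^n$ (i.e., $E_i$ is the $i$-th coordinate of a random element of $\{0,1\}^n$), with $X_i\in[0,1]$ and $X_n\in\{0,1\}$, such that every stopping time $\tau$ (with values in $\{1,\dots,n\}$) satisfies $\mathbb{E}[|X_\tau-X_{\tau-1}|]=C_n(X_0)$.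
   Context: A stopping time with respect to $(E_1,\dots,E_n)$ is a random variable $\tau$ such that for each $k$ the event $\{\tau\leq k\}$ is determined by $E_1,\dots,E_k$. $X_i$ is a function of $E_1,\dots,E_i$, $X_0$ is a constant, and $\mathbb{E}[X_{i+1}\mid E_1,\dots,E_i]=X_i$. Curves: a "curve" here is the graph $Y=f(X)$ of a function $f:[0,1]\to\mathbb{R}_{\ge 0}$. The transform $T$: given the curve $Y=f(X)$, $T$ of it is the curve $Y=g(X)$ where, for $x\in[0,1]$, $x_S(x)\in[0,1]$ is the solution of $X+f(X)=x$, $x_L(x)\in[0,1]$ is the solution of $X-f(X)=x$, and $g(x)=\mathrm{H.M.}(f(x_S(x)),f(x_L(x)))$, where $\mathrm{H.M.}(a,b)=2ab/(a+b)$ is the harmonic mean (taken to be $0$ if $a$ or $b$ is $0$). Define $C_1(X)=2X(1-X)$ and, for $n>1$, $C_n=T(C_{n-1})$, i.e. $C_n=T^{n-1}(C_1)$. *)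

theory Defs
  imports "HOL-Probability.Probability"
begin

definition harmonic_mean :: "real \<Rightarrow> real \<Rightarrow> real" where
  "harmonic_mean a b = (if a = 0 \<or> b = 0 then 0 else 2 * a * b / (a + b))"

text \<open>
  A curve is a function on \<open>[0,1]\<close>; values of the total functions below outside \<open>[0,1]\<close> are
  irrelevant. The defining equations of \<open>x_S\<close> and \<open>x_L\<close> are meant to have exactly one solution in
  \<open>[0,1]\<close>. This can fail at an endpoint: for \<open>f X = 2 * X * (1 - X)\<close>, both \<open>1/2\<close> and \<open>1\<close> solve
  \<open>X + f X = 1\<close>. Some solution is then chosen; which one does not matter there, because the other
  equation, \<open>X - f X = 1\<close>, is solved only by \<open>1\<close>, where \<open>f\<close> vanishes, so that the harmonic mean
  is \<open>0\<close> (and symmetrically at \<open>0\<close>).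
\<close>

definition x_S :: "(real \<Rightarrow> real) \<Rightarrow> real \<Rightarrow> real" where
  "x_S f x = (SOME X. X \<in> {0..1} \<and> X + f X = x)"

definition x_L :: "(real \<Rightarrow> real) \<Rightarrow> real \<Rightarrow> real" where
  "x_L f x = (SOME X. X \<in> {0..1} \<and> X - f X = x)"

definition curve_transform :: "(real \<Rightarrow> real) \<Rightarrow> real \<Rightarrow> real" where
  "curve_transform f x = harmonic_mean (f (x_S f x)) (f (x_L f x))"

text \<open>Only the curves with index \<open>n \<ge> 1\<close> are meaningful.\<close>

definition curve :: "nat \<Rightarrow> real \<Rightarrow> real" where
  "curve n = (curve_transform ^^ (n - 1)) (\<lambda>X. 2 * X * (1 - X))"

text \<open>
  The \<open>i\<close>-th \<open>\<sigma>\<close>-algebra is the one generated by \<open>E 1, \<dots>, E i\<close>, where \<open>E j\<close> takes values in the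
  measurable space \<open>N j\<close>; for \<open>i = 0\<close> it is trivial.
\<close>

definition exposure :: "'a measure \<Rightarrow> (nat \<Rightarrow> 'e measure) \<Rightarrow> (nat \<Rightarrow> 'a \<Rightarrow> 'e) \<Rightarrow> nat \<Rightarrow> 'a measure"
where
  "exposure M N E i =
     vimage_algebra (space M) (\<lambda>\<omega>. \<lambda>j\<in>{1..i}. E j \<omega>) (PiM {1..i} N)"

definition martingale_wrt ::
  "'a measure \<Rightarrow> (nat \<Rightarrow> 'e measure) \<Rightarrow> (nat \<Rightarrow> 'a \<Rightarrow> 'e) \<Rightarrow> nat \<Rightarrow> (nat \<Rightarrow> 'a \<Rightarrow> real) \<Rightarrow> bool"
where
  "martingale_wrt M N E n X \<longleftrightarrow>
     (\<forall>i\<in>{1..n}. E i \<in> measurable M (N i)) \<and>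
     (\<forall>i\<in>{0..n}. X i \<in> borel_measurable (exposure M N E i) \<and> integrable M (X i)) \<and>
     (\<forall>i\<in>{0..<n}. AE \<omega> in M. real_cond_exp M (exposure M N E i) (X (Suc i)) \<omega> = X i \<omega>)"

definition stopping_times ::
  "'a measure \<Rightarrow> (nat \<Rightarrow> 'e measure) \<Rightarrow> (nat \<Rightarrow> 'a \<Rightarrow> 'e) \<Rightarrow> nat \<Rightarrow> ('a \<Rightarrow> nat) set"
where
  "stopping_times M N E n =
     {\<tau>. stopping_time (exposure M N E) \<tau> \<and> (\<forall>\<omega>\<in>space M. \<tau> \<omega> \<in> {1..n})}"

definition expected_gap :: "'a measure \<Rightarrow> (nat \<Rightarrow> 'a \<Rightarrow> real) \<Rightarrow> ('a \<Rightarrow> nat) \<Rightarrow> real" where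
  "expected_gap M X \<tau> = (\<integral>\<omega>. \<bar>X (\<tau> \<omega>) \<omega> - X (\<tau> \<omega> - 1) \<omega>\<bar> \<partial>M)"

end

(* Let f = curve (n - 1). After the first step, at X_1 = y, one may stop with gap |y - x| or go on and
   secure f y, so the best one can do is the mean of max |y - x| (f y). This function of y lies above
   the chord of f over the points x_S and x_L, whose height at x is exactly curve_transform f x, and
   the martingale property integrates the chord to that height. The domination needs f concave;
   concavity is preserved by the transform because x - x_S and x_L - x are concave in x and the
   harmonic mean is a minimum of nonnegative linear forms. Equality holds when X_1 only visits x_S
   and x_L; then the jump sizes form a martingale themselves, and optional stopping gives the same
   expectation for every stopping time. *)

theory Submission
  imports Defs
begin

section \<open>Concave curves and the transform\<close>

text \<open>The points \<open>x_S\<close> and \<open>x_L\<close> are those where the gap to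
  \<open>x\<close> equals the value \<open>f\<close> of the remaining game, so stopping and going on
  are equally good there; this is where the transform comes from. The initial parabola is the mean
  size of a single move from \<open>x\<close> into \<open>{0, 1}\<close>. The obstacle in the lower
  bound is that one stopping time must serve all values of the process at once. The induction
  therefore runs backwards in time inside a fixed martingale, and its claim at time
  \<open>k\<close>, with \<open>n - k\<close> moves left, is tested on every event known at that
  time; the martingale property enters only through integrals against bounded multipliers. Concavity
  alone is too weak an invariant, since a concave function may jump at an endpoint; the bounds
  \<open>2 * x\<close> and \<open>2 * (1 - x)\<close> travel with it. The extremal example is
  finite: its expectations are weighted sums over bit strings, linked to measure theory through
  functions of the leading bits.\<close>

lemma harmonic_mean_eq:
  assumes "0 \<le> a" "0 \<le> b"
  shows "harmonic_mean a b = 2 * a * b / (a + b)"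
  using assms by (auto simp: harmonic_mean_def)

text \<open>Right side minus left side, times \<open>a + b\<close>, is twice the square of
  \<open>s * (a + b) - b\<close>. The harmonic mean thus lies below a family of linear forms in
  \<open>(a, b)\<close>; \<open>s = 1\<close> and \<open>s = 0\<close> give the bounds
  \<open>2 * a\<close> and \<open>2 * b\<close>.\<close>

lemma harmonic_mean_le:
  assumes "0 \<le> a" "0 \<le> b"
  shows "harmonic_mean a b \<le> 2 * (s\<^sup>2 * a + (1 - s)\<^sup>2 * b)"
proof (cases "a + b = 0")
  case True
  with assms show ?thesis by (simp add: harmonic_mean_eq)
next
  case False
  with assms have pos: "a + b > 0" by linarith
  have "(s\<^sup>2 * a + (1 - s)\<^sup>2 * b) * (a + b) - a * b = (s * (a + b) - b)\<^sup>2"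
    by (simp add: power2_eq_square algebra_simps)
  then have "a * b \<le> (s\<^sup>2 * a + (1 - s)\<^sup>2 * b) * (a + b)"
    by (smt (verit) zero_le_power2)
  then have "2 * a * b \<le> 2 * (s\<^sup>2 * a + (1 - s)\<^sup>2 * b) * (a + b)" by linarith
  with pos assms show ?thesis by (simp only: harmonic_mean_eq pos_divide_le_eq)
qed

text \<open>The choice \<open>s = b / (a + b)\<close> makes the square behind
  \<open>harmonic_mean_le\<close> vanish, so the harmonic mean is the minimum of that
  family.\<close>

lemma harmonic_mean_attained:
  assumes "0 \<le> a" "0 \<le> b"
  obtains s where "harmonic_mean a b = 2 * (s\<^sup>2 * a + (1 - s)\<^sup>2 * b)"
proof (cases "a + b = 0")
  case True
  with assms show ?thesis by (intro that[of 0]) (simp add: harmonic_mean_eq)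
next
  case False
  have "1 - b / (a + b) = a / (a + b)" using False by (simp add: field_simps)
  then have "(b / (a + b))\<^sup>2 * a + (1 - b / (a + b))\<^sup>2 * b = (b\<^sup>2 * a + a\<^sup>2 * b) / (a + b)\<^sup>2"
    by (simp add: power_divide add_divide_distrib)
  also have "\<dots> = (a * b) * (a + b) / ((a + b) * (a + b))"
    by (simp add: power2_eq_square algebra_simps)
  also have "\<dots> = a * b / (a + b)" using False by simp
  finally show ?thesis using assms by (intro that[of "b / (a + b)"]) (simp add: harmonic_mean_eq)
qed

section \<open>The invariant carried along the iteration of the transform\<close>

text \<open>The two upper bounds force the curve to vanish at 0 and 1 and to be continuous there.
  The transform preserves them, because it is at most twice each of the distances from
  \<open>x\<close> to the crossing points.\<close>

definition tame_curve :: "(real \<Rightarrow> real) \<Rightarrow> bool" where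
  "tame_curve f \<longleftrightarrow> concave_on {0..1} f \<and> (\<forall>x\<in>{0..1}. 0 \<le> f x \<and> f x \<le> 2 * x \<and> f x \<le> 2 * (1 - x))"

lemma tame_curveD:
  assumes "tame_curve f" "0 \<le> x" "x \<le> 1"
  shows "0 \<le> f x" "f x \<le> 2 * x" "f x \<le> 2 * (1 - x)"
  using assms by (auto simp: tame_curve_def)

lemma tame_curve_ends:
  assumes "tame_curve f"
  shows "f 0 = 0" "f 1 = 0"
  using tame_curveD[OF assms, of 0] tame_curveD[OF assms, of 1] by auto

lemma tame_curve_concave:
  assumes "tame_curve f" "0 \<le> t" "t \<le> 1" "0 \<le> x" "x \<le> 1" "0 \<le> y" "y \<le> 1"
  shows "(1 - t) * f x + t * f y \<le> f ((1 - t) * x + t * y)"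
  using concave_onD[of "{0..1}" f t x y] assms by (simp add: tame_curve_def)

text \<open>Reflection exchanges the equations of \<open>x_S\<close> and \<open>x_L\<close>, so
  facts about the upper crossing point are inherited from the lower one.\<close>

lemma tame_curve_reflect:
  assumes "tame_curve f"
  shows "tame_curve (\<lambda>x. f (1 - x))"
  unfolding tame_curve_def
proof (intro conjI ballI)
  show "concave_on {0..1} (\<lambda>x. f (1 - x))"
  proof (rule concave_on_linorderI)
    fix t x y :: real assume *: "0 < t" "t < 1" "x \<in> {0..1}" "y \<in> {0..1}" "x < y"
    have "(1 - t) * f (1 - x) + t * f (1 - y) \<le> f ((1 - t) * (1 - x) + t * (1 - y))"
      using * by (intro tame_curve_concave[OF assms]) auto
    also have "(1 - t) * (1 - x) + t * (1 - y) = 1 - ((1 - t) *\<^sub>R x + t *\<^sub>R y)"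
      by (simp add: algebra_simps)
    finally show "f (1 - ((1 - t) *\<^sub>R x + t *\<^sub>R y)) \<ge> (1 - t) * f (1 - x) + t * f (1 - y)" .
  qed auto
qed (use tame_curveD[OF assms, of "1 - x" for x] in auto)

lemma tame_curve_parabola: "tame_curve (\<lambda>x. 2 * x * (1 - x))"
  unfolding tame_curve_def
proof (intro conjI ballI)
  show "concave_on {0..1} (\<lambda>x::real. 2 * x * (1 - x))"
  proof (rule concave_on_linorderI)
    fix t x y :: real assume *: "0 < t" "t < 1"
    let ?z = "(1 - t) * x + t * y"
    have "2 * ?z * (1 - ?z) - ((1 - t) * (2 * x * (1 - x)) + t * (2 * y * (1 - y)))
      = 2 * (t * (1 - t)) * (x - y)\<^sup>2"
      by (simp add: power2_eq_square algebra_simps)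
    also have "\<dots> \<ge> 0" using * by simp
    finally show "2 * ((1 - t) *\<^sub>R x + t *\<^sub>R y) * (1 - ((1 - t) *\<^sub>R x + t *\<^sub>R y))
        \<ge> (1 - t) * (2 * x * (1 - x)) + t * (2 * y * (1 - y))"
      by simp
  qed auto
next
  fix x :: real assume "x \<in> {0..1}"
  then show "0 \<le> 2 * x * (1 - x)" "2 * x * (1 - x) \<le> 2 * x" "2 * x * (1 - x) \<le> 2 * (1 - x)"
    using mult_right_mono[of x 1 "1 - x"] by (auto simp: mult_left_le)
qed

text \<open>Concavity gives continuity in the open interval; at the ends the curve is squeezed
  between 0 and a line that vanishes there.\<close>

lemma tame_curve_continuous:
  assumes "tame_curve f"
  shows "continuous_on {0..1} f"
proof -
  have "continuous_on {0<..<1} (\<lambda>x. - f x)"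
    using assms by (intro convex_on_continuous)
      (auto simp: tame_curve_def concave_on_def intro: convex_on_subset)
  then have "continuous_on {0<..<1} f" using continuous_on_minus by fastforce
  then have interior: "isCont f x" if "0 < x" "x < 1" for x
    using that by (simp add: continuous_on_eq_continuous_at)
  have left: "continuous (at 0 within {0..1}) f" if "tame_curve f" for f
  proof -
    have "(f \<longlongrightarrow> 0) (at 0 within {0..1})"
    proof (rule tendsto_sandwich[of "\<lambda>_. 0" _ _ "\<lambda>x. 2 * x"])
      show "((\<lambda>x. 2 * x) \<longlongrightarrow> (0::real)) (at 0 within {0..1})"
        by (auto intro!: tendsto_eq_intros)
    qed (auto simp: eventually_at_filter tame_curveD[OF that])
    then show ?thesis by (simp add: continuous_within tame_curve_ends[OF that])
  qed
  have right: "continuous (at 1 within {0..1}) f"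
  proof -
    have "(f \<longlongrightarrow> 0) (at 1 within {0..1})"
    proof (rule tendsto_sandwich[of "\<lambda>_. 0" _ _ "\<lambda>x. 2 - 2 * x"])
      show "((\<lambda>x. 2 - 2 * x) \<longlongrightarrow> (0::real)) (at 1 within {0..1})"
        by (auto intro!: tendsto_eq_intros)
    qed (use tame_curveD[OF assms] in \<open>auto simp: eventually_at_filter right_diff_distrib intro!: always_eventually\<close>)
    then show ?thesis by (simp add: continuous_within tame_curve_ends[OF assms])
  qed
  show ?thesis
    unfolding continuous_on_eq_continuous_within
  proof
    fix x :: real assume "x \<in> {0..1}"
    then consider "x = 0" | "x = 1" | "0 < x" "x < 1" by fastforce
    then show "continuous (at x within {0..1}) f"
      using left[OF assms] right interior by cases (auto intro: continuous_at_imp_continuous_at_within)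
  qed
qed

section \<open>The crossing points and their convexity\<close>

text \<open>\<open>X + f X\<close> is concave, at least \<open>x\<close> at \<open>u\<close>, and
  equal to 1 at the endpoint 1. As \<open>v\<close> gives the endpoint positive weight and
  \<open>x < 1\<close>, the value at \<open>v\<close> exceeds \<open>x\<close> strictly. So a level
  below 1 is attained at most once.\<close>

lemma curve_crossing:
  assumes "tame_curve f" "0 \<le> u" "u < v" "v \<le> 1" "x < 1" "x \<le> u + f u"
  shows "x < v + f v"
proof -
  \<comment> \<open>The weight for which \<open>v\<close> is the mean of \<open>u\<close> and the
    endpoint 1.\<close>
  define t where "t = (v - u) / (1 - u)"
  have u: "1 - u > 0" using assms by linarith
  have t: "0 < t" "t \<le> 1"
    using u assms by (auto simp: t_def field_simps)
  have "t * (1 - u) = v - u" using u by (simp add: t_def)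
  then have v: "(1 - t) * u + t * 1 = v" by (simp add: algebra_simps)
  have "(1 - t) * f u + t * f 1 \<le> f ((1 - t) * u + t * 1)"
    using assms t by (intro tame_curve_concave) auto
  then have "(1 - t) * f u \<le> f v" using v by (simp add: tame_curve_ends[OF assms(1)])
  moreover have "(1 - t) * x \<le> (1 - t) * (u + f u)" using t assms by (intro mult_left_mono) auto
  moreover have "t * x < t * 1" using t assms by (intro mult_strict_left_mono) auto
  ultimately show ?thesis using v by (simp add: algebra_simps)
qed

lemma curve_crossing_ex1:
  assumes "tame_curve f" "0 \<le> x" "x < 1"
  shows "\<exists>!X. X \<in> {0..1} \<and> X + f X = x"
proof (rule ex_ex1I)
  have "continuous_on {0..1} (\<lambda>X. X + f X)"
    by (intro continuous_intros tame_curve_continuous assms)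
  then have "\<exists>X. 0 \<le> X \<and> X \<le> 1 \<and> X + f X = x"
    using assms tame_curve_ends[OF assms(1)] by (intro IVT') auto
  then show "\<exists>X. X \<in> {0..1} \<and> X + f X = x" by auto
next
  fix X Y assume "X \<in> {0..1} \<and> X + f X = x" "Y \<in> {0..1} \<and> Y + f Y = x"
  then show "X = Y"
    using curve_crossing[OF assms(1), of X Y x] curve_crossing[OF assms(1), of Y X x] assms
    by (cases X Y rule: linorder_cases) auto
qed

text \<open>The solutions \<open>x_S\<close> and \<open>x_L\<close>, with the arbitrary choice at the endpoints made definite.\<close>

definition lower_pt :: "(real \<Rightarrow> real) \<Rightarrow> real \<Rightarrow> real" where
  "lower_pt f x = (if x = 1 then 1 else x_S f x)"

definition upper_pt :: "(real \<Rightarrow> real) \<Rightarrow> real \<Rightarrow> real" where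
  "upper_pt f x = (if x = 0 then 0 else x_L f x)"

lemma lower_pt:
  assumes "tame_curve f" "0 \<le> x" "x \<le> 1"
  shows "0 \<le> lower_pt f x" "lower_pt f x \<le> x" "f (lower_pt f x) = x - lower_pt f x"
proof -
  have *: "lower_pt f x \<in> {0..1} \<and> lower_pt f x + f (lower_pt f x) = x"
  proof (cases "x = 1")
    case True
    then show ?thesis by (simp add: lower_pt_def tame_curve_ends[OF assms(1)])
  next
    case False
    then have "\<exists>X. X \<in> {0..1} \<and> X + f X = x" using curve_crossing_ex1[of f x] assms by auto
    from someI_ex[OF this] False show ?thesis by (simp add: lower_pt_def x_S_def)
  qed
  then show "0 \<le> lower_pt f x" "f (lower_pt f x) = x - lower_pt f x" by auto
  moreover have "0 \<le> f (lower_pt f x)" using * by (intro tame_curveD[OF assms(1)]) auto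
  ultimately show "lower_pt f x \<le> x" by simp
qed

text \<open>Turns upper bounds on the crossing point into a test on a candidate \<open>u\<close>:
  once a level is reached, every later point is strictly above it. Monotonicity and convexity of
  \<open>lower_pt\<close> both rest on this.\<close>

lemma lower_pt_least:
  assumes "tame_curve f" "0 \<le> x" "x < 1" "0 \<le> u" "x \<le> u + f u"
  shows "lower_pt f x \<le> u"
proof (rule ccontr)
  assume "\<not> ?thesis"
  then have "x < lower_pt f x + f (lower_pt f x)"
    using lower_pt[of f x] assms by (intro curve_crossing[of f u]) auto
  then show False using lower_pt[of f x] assms by simp
qed

lemma upper_pt_reflect:
  assumes "tame_curve f" "0 \<le> x" "x \<le> 1"
  shows "upper_pt f x = 1 - lower_pt (\<lambda>x. f (1 - x)) (1 - x)"
proof (cases "x = 0")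
  case True
  then show ?thesis by (simp add: upper_pt_def lower_pt_def)
next
  case False
  define l where "l = lower_pt (\<lambda>x. f (1 - x)) (1 - x)"
  note refl = tame_curve_reflect[OF assms(1)]
  have l: "0 \<le> l" "l \<le> 1 - x" "f (1 - l) = 1 - x - l"
    using lower_pt[OF refl, of "1 - x"] assms by (auto simp: l_def)
  have "x_L f x = 1 - l"
    unfolding x_L_def
  proof (rule some_equality)
    show "1 - l \<in> {0..1} \<and> 1 - l - f (1 - l) = x" using l assms by auto
  next
    \<comment> \<open>The choice operator is pinned down by uniqueness of the crossing for the
      reflected curve at level \<open>1 - x\<close>, which is below 1 because \<open>x\<close> is
      not 0.\<close>
    fix X assume X: "X \<in> {0..1} \<and> X - f X = x"
    have "\<exists>!Y. Y \<in> {0..1} \<and> Y + f (1 - Y) = 1 - x"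
      using curve_crossing_ex1[OF refl, of "1 - x"] assms False by auto
    moreover have "1 - X \<in> {0..1} \<and> (1 - X) + f (1 - (1 - X)) = 1 - x" using X by auto
    moreover have "l \<in> {0..1} \<and> l + f (1 - l) = 1 - x" using l assms by auto
    ultimately have "1 - X = l" by blast
    then show "X = 1 - l" by simp
  qed
  with False show ?thesis by (simp add: upper_pt_def l_def)
qed

lemma upper_pt:
  assumes "tame_curve f" "0 \<le> x" "x \<le> 1"
  shows "x \<le> upper_pt f x" "upper_pt f x \<le> 1" "f (upper_pt f x) = upper_pt f x - x"
  using lower_pt[OF tame_curve_reflect[OF assms(1)], of "1 - x"] assms
  by (auto simp: upper_pt_reflect)

text \<open>At an endpoint one crossing point is forced to be that endpoint, where \<open>f\<close>
  vanishes; both sides are then 0, whatever the choice operator picks for the other point.\<close>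

lemma curve_transform_eq:
  assumes "tame_curve f" "0 \<le> x" "x \<le> 1"
  shows "curve_transform f x = harmonic_mean (x - lower_pt f x) (upper_pt f x - x)"
proof -
  consider "x = 0" | "x = 1" | "0 < x" "x < 1" using assms by fastforce
  then show ?thesis
  proof cases
    case 1
    then have "x_S f x = 0" using lower_pt[of f x] assms by (simp add: lower_pt_def)
    then show ?thesis using 1 by (simp add: curve_transform_def harmonic_mean_def upper_pt_def tame_curve_ends[OF assms(1)])
  next
    case 2
    then have "x_L f x = 1" using upper_pt[of f x] assms by (simp add: upper_pt_def)
    then show ?thesis using 2 by (simp add: curve_transform_def harmonic_mean_def lower_pt_def tame_curve_ends[OF assms(1)])
  next
    case 3
    then show ?thesis using lower_pt[of f x] upper_pt[of f x] assms
      by (simp add: curve_transform_def lower_pt_def upper_pt_def)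
  qed
qed

text \<open>Each crossing point satisfies \<open>l + f l = x\<close>; averaging two such equations
  and using concavity of \<open>f\<close> shows that the averaged point reaches the averaged level,
  so \<open>lower_pt_least\<close> applies to it.\<close>

lemma lower_pt_convex:
  assumes f: "tame_curve f" and t: "0 < t" "t < 1" and xy: "0 \<le> x" "x \<le> 1" "0 \<le> y" "y \<le> 1" "x < y"
  shows "lower_pt f ((1 - t) * x + t * y) \<le> (1 - t) * lower_pt f x + t * lower_pt f y"
proof -
  let ?u = "(1 - t) * lower_pt f x + t * lower_pt f y" and ?z = "(1 - t) * x + t * y"
  note px = lower_pt[OF f xy(1,2)] and py = lower_pt[OF f xy(3,4)]
  \<comment> \<open>\<open>lower_pt_least\<close> demands a level below 1; it is strict because
    \<open>x < y \<le> 1\<close> and the weight \<open>1 - t\<close> of \<open>x\<close> is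
    positive.\<close>
  have "?z < (1 - t) * 1 + t * 1"
    using t xy by (intro add_less_le_mono mult_strict_left_mono mult_left_mono) auto
  moreover have "(1 - t) * f (lower_pt f x) + t * f (lower_pt f y) \<le> f ?u"
    using t px py xy by (intro tame_curve_concave[OF f]) auto
  then have "?z \<le> ?u + f ?u" by (simp add: px(3) py(3) algebra_simps)
  ultimately show ?thesis
    using t xy px(1) py(1) by (intro lower_pt_least[OF f]) auto
qed

lemma upper_pt_concave:
  assumes f: "tame_curve f" and t: "0 < t" "t < 1" and xy: "0 \<le> x" "x \<le> 1" "0 \<le> y" "y \<le> 1" "x < y"
  shows "(1 - t) * upper_pt f x + t * upper_pt f y \<le> upper_pt f ((1 - t) * x + t * y)"
proof -
  \<comment> \<open>Reflection reverses the order of the two points, so their weights are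
    exchanged.\<close>
  have "lower_pt (\<lambda>x. f (1 - x)) ((1 - (1 - t)) * (1 - y) + (1 - t) * (1 - x)) \<le>
    (1 - (1 - t)) * lower_pt (\<lambda>x. f (1 - x)) (1 - y) + (1 - t) * lower_pt (\<lambda>x. f (1 - x)) (1 - x)"
    using t xy by (intro lower_pt_convex[OF tame_curve_reflect[OF f]]) auto
  moreover have "(1 - (1 - t)) * (1 - y) + (1 - t) * (1 - x) = 1 - ((1 - t) * x + t * y)"
    by (simp add: algebra_simps)
  moreover have "(1 - t) * x + t * y \<le> (1 - t) * 1 + t * 1"
    using t xy by (intro add_mono mult_left_mono) auto
  moreover have "0 \<le> (1 - t) * x + t * y" using t xy by simp
  ultimately show ?thesis using xy by (simp add: upper_pt_reflect[OF f] algebra_simps)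
qed

lemma tame_curve_transform:
  assumes f: "tame_curve f"
  shows "tame_curve (curve_transform f)"
  unfolding tame_curve_def
proof (intro conjI ballI)
  show "concave_on {0..1} (curve_transform f)"
  proof (rule concave_on_linorderI)
    fix t x y :: real assume t: "0 < t" "t < 1" and "x \<in> {0..1}" "y \<in> {0..1}" and "x < y"
    then have xy: "0 \<le> x" "x \<le> 1" "0 \<le> y" "y \<le> 1" "x < y" by auto
    let ?z = "(1 - t) * x + t * y"
    have "?z \<le> (1 - t) * 1 + t * 1"
      using t xy by (intro add_mono mult_left_mono) auto
    moreover have "0 \<le> ?z" using t xy by simp
    ultimately have z: "0 \<le> ?z" "?z \<le> 1" by auto
    define a where "a = (\<lambda>w. w - lower_pt f w)"
    define b where "b = (\<lambda>w. upper_pt f w - w)"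
    have nn: "0 \<le> a w" "0 \<le> b w" and T: "curve_transform f w = harmonic_mean (a w) (b w)"
      if "0 \<le> w" "w \<le> 1" for w
      using lower_pt[OF f that] upper_pt[OF f that] curve_transform_eq[OF f that] by (auto simp: a_def b_def)
    \<comment> \<open>The linear form that attains the minimum at \<open>?z\<close> is kept fixed;
      at \<open>x\<close> and \<open>y\<close> the same form merely bounds the harmonic mean from
      above.\<close>
    obtain s where s: "harmonic_mean (a ?z) (b ?z) = 2 * (s\<^sup>2 * a ?z + (1 - s)\<^sup>2 * b ?z)"
      using harmonic_mean_attained nn[OF z] by blast
    have "(1 - t) * a x + t * a y \<le> a ?z"
      using lower_pt_convex[OF f t xy] by (simp add: a_def algebra_simps)
    moreover have "(1 - t) * b x + t * b y \<le> b ?z"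
      using upper_pt_concave[OF f t xy] by (simp add: b_def algebra_simps)
    ultimately have "2 * (s\<^sup>2 * ((1 - t) * a x + t * a y) + (1 - s)\<^sup>2 * ((1 - t) * b x + t * b y))
      \<le> 2 * (s\<^sup>2 * a ?z + (1 - s)\<^sup>2 * b ?z)"
      by (intro mult_left_mono add_mono) auto
    moreover have "(1 - t) * harmonic_mean (a x) (b x) \<le> (1 - t) * (2 * (s\<^sup>2 * a x + (1 - s)\<^sup>2 * b x))"
      using t xy by (intro mult_left_mono harmonic_mean_le nn) auto
    moreover have "t * harmonic_mean (a y) (b y) \<le> t * (2 * (s\<^sup>2 * a y + (1 - s)\<^sup>2 * b y))"
      using t xy by (intro mult_left_mono harmonic_mean_le nn) auto
    ultimately have "(1 - t) * harmonic_mean (a x) (b x) + t * harmonic_mean (a y) (b y) \<le> harmonic_mean (a ?z) (b ?z)"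
      unfolding s by (simp add: algebra_simps)
    then show "(1 - t) * curve_transform f x + t * curve_transform f y \<le> curve_transform f ((1 - t) *\<^sub>R x + t *\<^sub>R y)"
      using T xy z by simp
  qed auto
next
  fix x :: real assume "x \<in> {0..1}"
  then have x: "0 \<le> x" "x \<le> 1" by auto
  note pts = lower_pt[OF f x] upper_pt[OF f x] curve_transform_eq[OF f x]
  show "0 \<le> curve_transform f x"
    using pts by (simp add: harmonic_mean_eq)
  \<comment> \<open>The forms with \<open>s = 1\<close> and \<open>s = 0\<close> bound the transform
    by twice \<open>x - lower_pt f x\<close> and twice \<open>upper_pt f x - x\<close>.\<close>
  show "curve_transform f x \<le> 2 * x" "curve_transform f x \<le> 2 * (1 - x)"
    using pts harmonic_mean_le[of "x - lower_pt f x" "upper_pt f x - x" 1]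
      harmonic_mean_le[of "x - lower_pt f x" "upper_pt f x - x" 0] by auto
qed

lemma curve_1: "curve (Suc 0) = (\<lambda>x. 2 * x * (1 - x))"
  by (simp add: curve_def)

lemma curve_Suc: "m \<ge> 1 \<Longrightarrow> curve (Suc m) = curve_transform (curve m)"
  by (cases m) (simp_all add: curve_def)

lemma tame_curve_curve: "m \<ge> 1 \<Longrightarrow> tame_curve (curve m)"
proof (induction m rule: dec_induct)
  case base
  show ?case by (simp add: curve_1 tame_curve_parabola)
next
  case (step m)
  then show ?case by (simp add: curve_Suc tame_curve_transform)
qed

section \<open>Monotone crossing points and the supporting chord\<close>

lemma lower_pt_mono:
  assumes f: "tame_curve f"
  shows "mono_on {0..1} (lower_pt f)"
proof (rule mono_onI)
  fix x y :: real assume *: "x \<in> {0..1}" "y \<in> {0..1}" "x \<le> y"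
  show "lower_pt f x \<le> lower_pt f y"
  proof (cases "y = 1")
    case True
    then show ?thesis using lower_pt[OF f, of x] * by (simp add: lower_pt_def[of f 1])
  next
    case False
    then show ?thesis using * lower_pt[OF f, of y] by (intro lower_pt_least[OF f]) auto
  qed
qed

lemma upper_pt_mono:
  assumes f: "tame_curve f"
  shows "mono_on {0..1} (upper_pt f)"
  using mono_onD[OF lower_pt_mono[OF tame_curve_reflect[OF f]]]
  by (intro mono_onI) (auto simp: upper_pt_reflect[OF f])

text \<open>With \<open>l\<close> and \<open>u\<close> the crossing points, this is the slope of the
  line through \<open>(l, x - l)\<close> and \<open>(u, u - x)\<close>. If \<open>l = u\<close>,
  division by zero makes it 0.\<close>

definition chord_slope :: "(real \<Rightarrow> real) \<Rightarrow> real \<Rightarrow> real" where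
  "chord_slope f x = (upper_pt f x + lower_pt f x - 2 * x) / (upper_pt f x - lower_pt f x)"

text \<open>The numerator is the difference of the nonnegative lengths \<open>u - x\<close> and
  \<open>x - l\<close>, the denominator their sum. The bound 1 later makes the slope an admissible
  multiplier for the martingale property.\<close>

lemma chord_slope_bounded:
  assumes "tame_curve f" "0 \<le> x" "x \<le> 1"
  shows "\<bar>chord_slope f x\<bar> \<le> 1"
  using lower_pt[OF assms] upper_pt[OF assms]
  by (simp add: chord_slope_def abs_divide divide_le_eq_1) linarith

text \<open>The chord through the points of the curve over \<open>x_S\<close> and \<open>x_L\<close> has height \<open>T f x\<close> at \<open>x\<close>;
  it lies below \<open>f\<close> between them by concavity and below \<open>\<bar>y - x\<bar>\<close> elsewhere because its slope is
  at most 1 in absolute value.\<close>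

lemma chord_le_max:
  assumes f: "tame_curve f" and x: "0 \<le> x" "x \<le> 1" and y: "0 \<le> y" "y \<le> 1"
  shows "curve_transform f x + chord_slope f x * (y - x) \<le> max \<bar>y - x\<bar> (f y)"
proof -
  note pts = lower_pt[OF f x] upper_pt[OF f x]
  define l u where "l = lower_pt f x" and "u = upper_pt f x"
  have lu: "0 \<le> l" "l \<le> x" "x \<le> u" "u \<le> 1" "f l = x - l" "f u = u - x"
    using pts by (auto simp: l_def u_def)
  have T: "curve_transform f x = 2 * (x - l) * (u - x) / (u - l)"
    using lu curve_transform_eq[OF f x] by (simp add: harmonic_mean_eq l_def u_def)
  have S: "chord_slope f x = (u + l - 2 * x) / (u - l)" by (simp add: chord_slope_def l_def u_def)
  show ?thesis
  proof (cases "u = l")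
    case True
    then show ?thesis by (simp add: T S)
  next
    case False
    with lu have pos: "u - l > 0" by linarith
    have eq: "curve_transform f x + chord_slope f x * (y - x)
      = (2 * (x - l) * (u - x) + (u + l - 2 * x) * (y - x)) / (u - l)"
      by (simp add: T S add_divide_distrib)
    consider "y < l" | "u < y" | "l \<le> y" "y \<le> u" by linarith
    then show ?thesis
    proof cases
      case 1
      \<comment> \<open>The excess factors because the chord passes through
        \<open>(l, x - l)\<close>, a point of the graph of \<open>\<bar>y - x\<bar>\<close>.\<close>
      have "(x - y) * (u - l) - (2 * (x - l) * (u - x) + (u + l - 2 * x) * (y - x)) = 2 * (u - x) * (l - y)"
        by (simp add: algebra_simps)
      also have "\<dots> \<ge> 0" using 1 lu by simp
      finally have "curve_transform f x + chord_slope f x * (y - x) \<le> x - y"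
        unfolding eq using pos by (simp add: divide_le_eq)
      then show ?thesis by linarith
    next
      case 2
      have "(y - x) * (u - l) - (2 * (x - l) * (u - x) + (u + l - 2 * x) * (y - x)) = 2 * (x - l) * (y - u)"
        by (simp add: algebra_simps)
      also have "\<dots> \<ge> 0" using 2 lu by simp
      finally have "curve_transform f x + chord_slope f x * (y - x) \<le> y - x"
        unfolding eq using pos by (simp add: divide_le_eq)
      then show ?thesis by linarith
    next
      case 3
      define t where "t = (y - l) / (u - l)"
      have t: "0 \<le> t" "t \<le> 1" using 3 pos by (auto simp: t_def)
      have tl: "t * (u - l) = y - l" using pos by (simp add: t_def)
      have ty: "(1 - t) * l + t * u = y" using tl by (simp add: algebra_simps)
      have "(1 - t) * f l + t * f u \<le> f ((1 - t) * l + t * u)"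
        using t lu x by (intro tame_curve_concave[OF f]) auto
      then have "(1 - t) * (x - l) + t * (u - x) \<le> f y" unfolding ty lu(5,6) .
      \<comment> \<open>Height and slope combine to the linear interpolation between the chord's end
        values \<open>x - l\<close> and \<open>u - x\<close>.\<close>
      moreover have "(2 * (x - l) * (u - x) + (u + l - 2 * x) * (y - x)) =
          ((1 - t) * (x - l) + t * (u - x)) * (u - l)"
        using tl ty by algebra
      ultimately show ?thesis unfolding eq using pos by simp
    qed
  qed
qed

section \<open>The lower bound for an arbitrary martingale\<close>

text \<open>Curves are controlled on \<open>{0..1}\<close> only, so their measurability refers to
  the restricted space; a process with values there absorbs the restriction.\<close>

lemma borel_measurable_compose_restrict:
  fixes f :: "real \<Rightarrow> real"
  assumes "f \<in> borel_measurable (restrict_space borel A)"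
    and "X \<in> borel_measurable M" "\<And>\<omega>. \<omega> \<in> space M \<Longrightarrow> X \<omega> \<in> A"
  shows "(\<lambda>\<omega>. f (X \<omega>)) \<in> borel_measurable M"
proof -
  have "X \<in> measurable M (restrict_space borel A)"
    using assms(2,3) by (intro measurable_restrict_space2) auto
  then show ?thesis using assms(1) by (rule measurable_compose)
qed

lemma borel_measurable_tame_curve:
  assumes "tame_curve f" "X \<in> borel_measurable M" "\<And>\<omega>. \<omega> \<in> space M \<Longrightarrow> X \<omega> \<in> {0..1}"
  shows "(\<lambda>\<omega>. f (X \<omega>)) \<in> borel_measurable M"
  by (rule borel_measurable_compose_restrict[OF
        borel_measurable_continuous_on_restrict[OF tame_curve_continuous[OF assms(1)]] assms(2,3)])

text \<open>Both crossing points are monotone in \<open>x\<close>, hence Borel, and the slope is a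
  rational expression in them.\<close>

lemma borel_measurable_chord_slope:
  assumes "tame_curve f" "X \<in> borel_measurable M" "\<And>\<omega>. \<omega> \<in> space M \<Longrightarrow> X \<omega> \<in> {0..1}"
  shows "(\<lambda>\<omega>. chord_slope f (X \<omega>)) \<in> borel_measurable M"
proof -
  have [measurable]: "X \<in> borel_measurable M"
    "(\<lambda>\<omega>. lower_pt f (X \<omega>)) \<in> borel_measurable M" "(\<lambda>\<omega>. upper_pt f (X \<omega>)) \<in> borel_measurable M"
    using borel_measurable_compose_restrict[OF borel_measurable_mono_on_fnc assms(2,3)]
      lower_pt_mono[OF assms(1)] upper_pt_mono[OF assms(1)] assms(2) by blast+
  show ?thesis unfolding chord_slope_def by measurable
qed

section \<open>Backward induction on stopping times\<close>

abbreviation gap :: "(nat \<Rightarrow> 'a \<Rightarrow> real) \<Rightarrow> ('a \<Rightarrow> nat) \<Rightarrow> 'a \<Rightarrow> real" where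
  "gap X \<tau> \<omega> \<equiv> \<bar>X (\<tau> \<omega>) \<omega> - X (\<tau> \<omega> - 1) \<omega>\<bar>"

text \<open>The martingale property is stated in integrated form, against multipliers bounded by 1,
  which is how it is used throughout the induction. The range holds at every point, so that
  inequalities for curves can be applied pointwise.\<close>

locale unit_martingale = prob_space M for M :: "'a measure" +
  fixes F :: "nat \<Rightarrow> 'a measure" and X :: "nat \<Rightarrow> 'a \<Rightarrow> real" and n :: nat
  assumes n_pos: "n \<ge> 1"
    and sub: "\<And>i. i \<le> n \<Longrightarrow> subalgebra M (F i)"
    and F_mono: "\<And>i j. i \<le> j \<Longrightarrow> j \<le> n \<Longrightarrow> sets (F i) \<subseteq> sets (F j)"
    and space_F: "\<And>i. space (F i) = space M"
    and adapted: "\<And>i. i \<le> n \<Longrightarrow> X i \<in> borel_measurable (F i)"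
    and martingale: "\<And>i Z. i < n \<Longrightarrow> Z \<in> borel_measurable (F i) \<Longrightarrow> (\<And>\<omega>. \<omega> \<in> space M \<Longrightarrow> \<bar>Z \<omega>\<bar> \<le> 1)
      \<Longrightarrow> (\<integral>\<omega>. Z \<omega> * X (Suc i) \<omega> \<partial>M) = (\<integral>\<omega>. Z \<omega> * X i \<omega> \<partial>M)"
    and range: "\<And>i \<omega>. i \<le> n \<Longrightarrow> \<omega> \<in> space M \<Longrightarrow> X i \<omega> \<in> {0..1}"
    and final: "AE \<omega> in M. X n \<omega> \<in> {0, 1}"
begin

lemma measurable_F_le:
  assumes "i \<le> j" "j \<le> n" "f \<in> borel_measurable (F i)"
  shows "f \<in> borel_measurable (F j)"
  using assms F_mono[of i j] by (auto simp: measurable_def space_F)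

lemma measurable_F_M:
  assumes "i \<le> n" "f \<in> borel_measurable (F i)"
  shows "f \<in> borel_measurable M"
  using assms measurable_from_subalg sub by blast

lemma integrable_bounded:
  fixes f :: "'a \<Rightarrow> real"
  assumes "f \<in> borel_measurable M" "\<And>\<omega>. \<omega> \<in> space M \<Longrightarrow> \<bar>f \<omega>\<bar> \<le> c"
  shows "integrable M f"
  using assms by (intro integrable_const_bound[of _ c]) auto

text \<open>Before time \<open>Suc k\<close> neither branch has stopped; from then on
  \<open>D\<close> is a known event, and the two rules can be combined.\<close>

lemma stopping_step:
  assumes k: "k < n" and D: "D \<in> sets (F (Suc k))"
    and \<tau>': "stopping_time F \<tau>'" "\<And>\<omega>. \<omega> \<in> space M \<Longrightarrow> Suc (Suc k) \<le> \<tau>' \<omega> \<and> \<tau>' \<omega> \<le> n"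
  shows "stopping_time F (\<lambda>\<omega>. if \<omega> \<in> D then Suc k else \<tau>' \<omega>)" (is "stopping_time F ?\<tau>")
  unfolding stopping_time_def
proof
  fix t :: nat
  consider "t \<le> k" | "Suc k \<le> t" "t \<le> n" | "n < t" using k by linarith
  then show "Measurable.pred (F t) (\<lambda>\<omega>. ?\<tau> \<omega> \<le> t)"
  proof cases
    case 1
    then have "(?\<tau> \<omega> \<le> t) = False" if "\<omega> \<in> space (F t)" for \<omega>
      using \<tau>'(2)[of \<omega>] that by (auto simp: space_F)
    then have "Measurable.pred (F t) (\<lambda>\<omega>. ?\<tau> \<omega> \<le> t) = Measurable.pred (F t) (\<lambda>\<omega>. False)"
      by (rule measurable_cong)
    then show ?thesis by simp
  next
    case 2
    have [measurable]: "D \<in> sets (F t)" using D F_mono 2 by blast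
    have [measurable]: "Measurable.pred (F t) (\<lambda>\<omega>. \<tau>' \<omega> \<le> t)" using \<tau>'(1) by (simp add: stopping_time_def)
    have "(\<lambda>\<omega>. ?\<tau> \<omega> \<le> t) = (\<lambda>\<omega>. \<omega> \<in> D \<or> \<tau>' \<omega> \<le> t)" using 2 by auto
    then show ?thesis by simp
  next
    \<comment> \<open>Beyond \<open>n\<close> only the underlying space of \<open>F t\<close> is
      known, but by then every path has stopped and the event is everything.\<close>
    case 3
    then have "(?\<tau> \<omega> \<le> t) = True" if "\<omega> \<in> space (F t)" for \<omega>
      using \<tau>'(2)[of \<omega>] k that by (auto simp: space_F)
    then have "Measurable.pred (F t) (\<lambda>\<omega>. ?\<tau> \<omega> \<le> t) = Measurable.pred (F t) (\<lambda>\<omega>. True)"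
      by (rule measurable_cong)
    then show ?thesis by simp
  qed
qed

text \<open>The conditional mean of the gap given \<open>F k\<close> is at least
  \<open>curve (n - k) (X k)\<close>, expressed by integrals over events. Quantifying over all
  \<open>B\<close> allows the claim to be used on just the part of the space where one goes on.
  Integrability is recorded so that integrals can be split.\<close>

definition secures :: "nat \<Rightarrow> ('a \<Rightarrow> nat) \<Rightarrow> bool" where
  "secures k \<tau> \<longleftrightarrow> stopping_time F \<tau> \<and> (\<forall>\<omega>\<in>space M. Suc k \<le> \<tau> \<omega> \<and> \<tau> \<omega> \<le> n) \<and>
     integrable M (gap X \<tau>) \<and>
     (\<forall>B\<in>sets (F k). (\<integral>\<omega>. indicator B \<omega> * curve (n - k) (X k \<omega>) \<partial>M)
        \<le> (\<integral>\<omega>. indicator B \<omega> * gap X \<tau> \<omega> \<partial>M))"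

text \<open>For a final value in \<open>{0, 1}\<close>, the gap to \<open>x\<close> equals
  \<open>(1 - 2 * x) * X n + x\<close>, which is linear in \<open>X n\<close>. The martingale
  property replaces \<open>X n\<close> by \<open>x\<close> and yields
  \<open>2 * x * (1 - x)\<close>, with equality.\<close>

lemma secures_last:
  assumes n: "n = Suc k"
  shows "secures k (\<lambda>_. n)"
proof -
  have k: "k < n" "k \<le> n" using n by auto
  have curve: "curve (n - k) x = 2 * x * (1 - x)" for x by (simp add: n curve_1)
  have pred: "n - 1 = k" using n by simp
  have Xk_F [measurable]: "X k \<in> borel_measurable (F k)" using adapted k by auto
  have XM [measurable]: "X n \<in> borel_measurable M" "X k \<in> borel_measurable M"
    using adapted k measurable_F_M by blast+
  have r: "0 \<le> X k \<omega>" "X k \<omega> \<le> 1" "0 \<le> X n \<omega>" "X n \<omega> \<le> 1" if "\<omega> \<in> space M" for \<omega>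
    using range[of k \<omega>] range[of n \<omega>] k that by auto
  have bnd: "\<bar>1 - 2 * X k \<omega>\<bar> \<le> 1" "\<bar>X k \<omega>\<bar> \<le> 1" "\<bar>X n \<omega>\<bar> \<le> 1" "\<bar>X n \<omega> - X k \<omega>\<bar> \<le> 1"
    if "\<omega> \<in> space M" for \<omega>
    using r[OF that] by (auto simp: abs_le_iff)
  have "integrable M (gap X (\<lambda>_. n))"
    unfolding pred using bnd by (intro integrable_bounded[of _ 1]) auto
  moreover have "(\<integral>\<omega>. indicator B \<omega> * curve (n - k) (X k \<omega>) \<partial>M)
      \<le> (\<integral>\<omega>. indicator B \<omega> * gap X (\<lambda>_. n) \<omega> \<partial>M)" if B: "B \<in> sets (F k)" for B
  proof -
    have [measurable]: "B \<in> sets (F k)" "B \<in> sets M" using B sub[of k] k by (auto simp: subalgebra_def)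
    define Z where "Z = (\<lambda>\<omega>. indicator B \<omega> * (1 - 2 * X k \<omega>))"
    have Z [measurable]: "Z \<in> borel_measurable (F k)" "Z \<in> borel_measurable M" by (auto simp: Z_def)
    have Z1: "\<bar>Z \<omega>\<bar> \<le> 1" if "\<omega> \<in> space M" for \<omega>
      using bnd(1)[OF that] by (auto simp: Z_def indicator_def)
    have int: "integrable M (\<lambda>\<omega>. Z \<omega> * X n \<omega>)" "integrable M (\<lambda>\<omega>. Z \<omega> * X k \<omega>)"
        "integrable M (\<lambda>\<omega>. indicator B \<omega> * X k \<omega>)"
      using Z1 bnd by (auto intro!: integrable_bounded[of _ 1] mult_le_one simp: abs_mult indicator_def)
    have "(\<integral>\<omega>. indicator B \<omega> * curve (n - k) (X k \<omega>) \<partial>M)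
        = (\<integral>\<omega>. Z \<omega> * X k \<omega> + indicator B \<omega> * X k \<omega> \<partial>M)"
      by (intro Bochner_Integration.integral_cong) (auto simp: curve Z_def algebra_simps)
    also have "\<dots> = (\<integral>\<omega>. Z \<omega> * X n \<omega> + indicator B \<omega> * X k \<omega> \<partial>M)"
      using int martingale[OF k(1) Z(1) Z1] by (simp flip: n)
    also have "\<dots> = (\<integral>\<omega>. indicator B \<omega> * \<bar>X n \<omega> - X k \<omega>\<bar> \<partial>M)"
    proof (rule integral_cong_AE)
      show "AE \<omega> in M. Z \<omega> * X n \<omega> + indicator B \<omega> * X k \<omega> = indicator B \<omega> * \<bar>X n \<omega> - X k \<omega>\<bar>"
        using final AE_space
      proof eventually_elim
        case (elim \<omega>)
        then show ?case using r[of \<omega>] by (auto simp: Z_def indicator_def)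
      qed
    qed simp_all
    finally show ?thesis by (simp only: pred)
  qed
  moreover have "stopping_time F (\<lambda>_. n)" by (simp add: stopping_time_def)
  ultimately show ?thesis unfolding secures_def using k by auto
qed

lemma secures_step:
  assumes k: "Suc k < n" and IH: "secures (Suc k) \<tau>'"
  shows "\<exists>\<tau>. secures k \<tau>"
proof -
  define f where "f = curve (n - Suc k)"
  have f: "tame_curve f" using k by (simp add: f_def tame_curve_curve)
  have Tf: "curve (n - k) = curve_transform f"
    using k curve_Suc[of "n - Suc k"] by (simp add: f_def Suc_diff_Suc)
  have Tf_tame: "tame_curve (curve_transform f)" using f by (rule tame_curve_transform)
  let ?x = "X k" and ?y = "X (Suc k)"
  have ranges: "?x \<omega> \<in> {0..1}" "?y \<omega> \<in> {0..1}" if "\<omega> \<in> space M" for \<omega>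
    using range that k by auto
  have x_F [measurable]: "?x \<in> borel_measurable (F k)" using adapted k by auto
  have y_F [measurable]: "?y \<in> borel_measurable (F (Suc k))" using adapted k by auto
  have x_F' [measurable]: "?x \<in> borel_measurable (F (Suc k))" by (rule measurable_F_le[OF _ _ x_F]) (use k in auto)
  have M [measurable]: "?x \<in> borel_measurable M" "?y \<in> borel_measurable M"
    by (rule measurable_F_M[OF _ x_F] measurable_F_M[OF _ y_F], use k in simp)+
  have fy_F [measurable]: "(\<lambda>\<omega>. f (?y \<omega>)) \<in> borel_measurable (F (Suc k))"
    by (rule borel_measurable_tame_curve[OF f y_F]) (use ranges in \<open>simp add: space_F\<close>)
  have fM [measurable]: "(\<lambda>\<omega>. f (?y \<omega>)) \<in> borel_measurable M" "(\<lambda>\<omega>. curve_transform f (?x \<omega>)) \<in> borel_measurable M"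
    by (rule borel_measurable_tame_curve[OF f M(2) ranges(2)] borel_measurable_tame_curve[OF Tf_tame M(1) ranges(1)];
        assumption)+
  have slope_F [measurable]: "(\<lambda>\<omega>. chord_slope f (?x \<omega>)) \<in> borel_measurable (F k)"
    by (rule borel_measurable_chord_slope[OF f x_F]) (use ranges in \<open>simp add: space_F\<close>)
  have slope_M [measurable]: "(\<lambda>\<omega>. chord_slope f (?x \<omega>)) \<in> borel_measurable M"
    by (rule measurable_F_M[OF _ slope_F]) (use k in simp)
  \<comment> \<open>Stop at once when the gap at hand is at least the value \<open>f\<close> that
    going on secures.\<close>
  define D where "D = {\<omega> \<in> space (F (Suc k)). f (?y \<omega>) \<le> \<bar>?y \<omega> - ?x \<omega>\<bar>}"
  have D_F [measurable]: "D \<in> sets (F (Suc k))" unfolding D_def by measurable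
  have D_M [measurable]: "D \<in> sets M" using D_F sub[of "Suc k"] k by (auto simp: subalgebra_def)
  define \<tau> where "\<tau> = (\<lambda>\<omega>. if \<omega> \<in> D then Suc k else \<tau>' \<omega>)"
  have \<tau>': "stopping_time F \<tau>'" "\<And>\<omega>. \<omega> \<in> space M \<Longrightarrow> Suc (Suc k) \<le> \<tau>' \<omega> \<and> \<tau>' \<omega> \<le> n"
    "integrable M (gap X \<tau>')"
    using IH by (auto simp: secures_def)
  have gap_\<tau>: "gap X \<tau> \<omega> = indicator D \<omega> * \<bar>?y \<omega> - ?x \<omega>\<bar> + indicator (space M - D) \<omega> * gap X \<tau>' \<omega>"
    if "\<omega> \<in> space M" for \<omega>
    using that by (simp add: \<tau>_def indicator_def)
  have bnd: "\<bar>f (?y \<omega>)\<bar> \<le> 2" "\<bar>curve_transform f (?x \<omega>)\<bar> \<le> 2" "\<bar>?y \<omega> - ?x \<omega>\<bar> \<le> 1" "\<bar>chord_slope f (?x \<omega>)\<bar> \<le> 1"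
    "\<bar>?x \<omega>\<bar> \<le> 1" "\<bar>?y \<omega>\<bar> \<le> 1"
    if "\<omega> \<in> space M" for \<omega>
    using ranges[OF that] tame_curveD[OF f, of "?y \<omega>"] tame_curveD[OF Tf_tame, of "?x \<omega>"]
      chord_slope_bounded[OF f, of "?x \<omega>"] by auto
  have int_D: "integrable M (\<lambda>\<omega>. indicator A \<omega> * \<bar>?y \<omega> - ?x \<omega>\<bar>)" if [measurable]: "A \<in> sets M" for A
    using bnd by (intro integrable_bounded[of _ 1]) (auto simp: indicator_def)
  have int_f: "integrable M (\<lambda>\<omega>. indicator A \<omega> * f (?y \<omega>))" if [measurable]: "A \<in> sets M" for A
    using bnd by (intro integrable_bounded[of _ 2]) (auto simp: indicator_def)
  have int_gap: "integrable M (\<lambda>\<omega>. indicator A \<omega> * gap X \<tau>' \<omega>)" if [measurable]: "A \<in> sets M" for A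
    using integrable_real_mult_indicator[OF that \<tau>'(3)] by (simp add: mult.commute)
  have "stopping_time F \<tau>"
    unfolding \<tau>_def using k by (intro stopping_step D_F \<tau>') auto
  moreover have "\<forall>\<omega>\<in>space M. Suc k \<le> \<tau> \<omega> \<and> \<tau> \<omega> \<le> n"
    using \<tau>'(2) k by (fastforce simp: \<tau>_def)
  moreover have "integrable M (gap X \<tau>)"
    using Bochner_Integration.integrable_add[OF int_D[OF D_M] int_gap[OF sets.Diff[OF sets.top D_M]]]
    by (subst Bochner_Integration.integrable_cong[OF refl gap_\<tau>])
  moreover have "(\<integral>\<omega>. indicator B \<omega> * curve (n - k) (?x \<omega>) \<partial>M) \<le> (\<integral>\<omega>. indicator B \<omega> * gap X \<tau> \<omega> \<partial>M)"
    if B: "B \<in> sets (F k)" for B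
  proof -
    have [measurable]: "B \<in> sets (F k)" "B \<in> sets M" "B \<in> sets (F (Suc k))"
      using B sub[of k] F_mono[of k "Suc k"] k by (auto simp: subalgebra_def)
    define C where "C = B \<inter> (space (F (Suc k)) - D)"
    have C: "C = B \<inter> (space M - D)" by (simp add: C_def space_F)
    have C_F: "C \<in> sets (F (Suc k))" unfolding C_def by measurable
    have C_M [measurable]: "C \<in> sets M" unfolding C by measurable
    \<comment> \<open>The multiplier known at time \<open>k\<close> for which
      \<open>Z * (y - x)\<close> has integral 0; adding this term turns the height of the chord at
      \<open>x\<close> into its height at \<open>y\<close>.\<close>
    define Z where "Z = (\<lambda>\<omega>. indicator B \<omega> * chord_slope f (?x \<omega>))"
    have Z [measurable]: "Z \<in> borel_measurable (F k)" "Z \<in> borel_measurable M" by (auto simp: Z_def)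
    have Z1: "\<bar>Z \<omega>\<bar> \<le> 1" if "\<omega> \<in> space M" for \<omega>
      using bnd(4)[OF that] by (auto simp: Z_def indicator_def)
    have int: "integrable M (\<lambda>\<omega>. Z \<omega> * ?y \<omega>)" "integrable M (\<lambda>\<omega>. Z \<omega> * ?x \<omega>)"
      using Z1 bnd by (auto intro!: integrable_bounded[of _ 1] mult_le_one simp: abs_mult)
    have int_T: "integrable M (\<lambda>\<omega>. indicator B \<omega> * curve_transform f (?x \<omega>))"
      using bnd by (intro integrable_bounded[of _ 2]) (auto simp: indicator_def)
    have "(\<integral>\<omega>. indicator B \<omega> * curve_transform f (?x \<omega>) \<partial>M)
      = (\<integral>\<omega>. indicator B \<omega> * curve_transform f (?x \<omega>) + (Z \<omega> * ?y \<omega> - Z \<omega> * ?x \<omega>) \<partial>M)"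
      using int int_T martingale[OF _ Z(1) Z1] k by simp
    also have "\<dots> \<le> (\<integral>\<omega>. indicator (B \<inter> D) \<omega> * \<bar>?y \<omega> - ?x \<omega>\<bar> + indicator C \<omega> * f (?y \<omega>) \<partial>M)"
    proof (rule integral_mono)
      fix \<omega> assume \<omega>: "\<omega> \<in> space M"
      have "curve_transform f (?x \<omega>) + chord_slope f (?x \<omega>) * (?y \<omega> - ?x \<omega>) \<le> max \<bar>?y \<omega> - ?x \<omega>\<bar> (f (?y \<omega>))"
        using ranges[OF \<omega>] by (intro chord_le_max[OF f]) auto
      then show "indicator B \<omega> * curve_transform f (?x \<omega>) + (Z \<omega> * ?y \<omega> - Z \<omega> * ?x \<omega>)
        \<le> indicator (B \<inter> D) \<omega> * \<bar>?y \<omega> - ?x \<omega>\<bar> + indicator C \<omega> * f (?y \<omega>)"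
        using \<omega> by (auto simp: Z_def C D_def space_F indicator_def max_def right_diff_distrib split: if_splits)
    qed (use int int_T int_D int_f in auto)
    also have "\<dots> = (\<integral>\<omega>. indicator (B \<inter> D) \<omega> * \<bar>?y \<omega> - ?x \<omega>\<bar> \<partial>M) + (\<integral>\<omega>. indicator C \<omega> * f (?y \<omega>) \<partial>M)"
      by (intro Bochner_Integration.integral_add int_D int_f) auto
    \<comment> \<open>The induction hypothesis is used on \<open>C\<close>, an event of time
      \<open>Suc k\<close> that depends on the newest value.\<close>
    also have "(\<integral>\<omega>. indicator C \<omega> * f (?y \<omega>) \<partial>M) \<le> (\<integral>\<omega>. indicator C \<omega> * gap X \<tau>' \<omega> \<partial>M)"
      using IH C_F by (simp add: secures_def f_def)
    also have "(\<integral>\<omega>. indicator (B \<inter> D) \<omega> * \<bar>?y \<omega> - ?x \<omega>\<bar> \<partial>M) + \<dots>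
      = (\<integral>\<omega>. indicator (B \<inter> D) \<omega> * \<bar>?y \<omega> - ?x \<omega>\<bar> + indicator C \<omega> * gap X \<tau>' \<omega> \<partial>M)"
      by (intro Bochner_Integration.integral_add[symmetric] int_D int_gap) auto
    also have "\<dots> = (\<integral>\<omega>. indicator B \<omega> * gap X \<tau> \<omega> \<partial>M)"
      by (intro Bochner_Integration.integral_cong) (auto simp: \<tau>_def C indicator_def)
    finally show ?thesis by (simp add: Tf)
  qed
  ultimately have "secures k \<tau>" by (simp add: secures_def)
  then show ?thesis by blast
qed

lemma exists_secures: "\<exists>\<tau>. secures 0 \<tau>"
proof -
  have "0 \<le> n - 1" by simp
  then show ?thesis
  proof (induction rule: inc_induct)
    case base
    show ?case using secures_last[of "n - 1"] n_pos by auto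
  next
    case (step k)
    then obtain \<tau> where "secures (Suc k) \<tau>" by blast
    then show ?case using step by (intro secures_step) auto
  qed
qed

lemma exists_stopping_time:
  assumes "\<And>\<omega>. \<omega> \<in> space M \<Longrightarrow> X 0 \<omega> = x0"
  shows "\<exists>\<tau>. stopping_time F \<tau> \<and> (\<forall>\<omega>\<in>space M. \<tau> \<omega> \<in> {1..n}) \<and>
    curve n x0 \<le> (\<integral>\<omega>. gap X \<tau> \<omega> \<partial>M)"
proof -
  obtain \<tau> where "secures 0 \<tau>" using exists_secures ..
  then have \<tau>: "stopping_time F \<tau>" "\<And>\<omega>. \<omega> \<in> space M \<Longrightarrow> \<tau> \<omega> \<in> {1..n}"
    and le: "(\<integral>\<omega>. indicator (space (F 0)) \<omega> * curve n (X 0 \<omega>) \<partial>M) \<le> (\<integral>\<omega>. indicator (space (F 0)) \<omega> * gap X \<tau> \<omega> \<partial>M)"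
    by (auto simp: secures_def)
  have "(\<integral>\<omega>. indicator (space (F 0)) \<omega> * curve n (X 0 \<omega>) \<partial>M) = (\<integral>\<omega>. curve n x0 \<partial>M)"
    by (intro Bochner_Integration.integral_cong) (auto simp: assms space_F)
  moreover have "(\<integral>\<omega>. indicator (space (F 0)) \<omega> * gap X \<tau> \<omega> \<partial>M) = (\<integral>\<omega>. gap X \<tau> \<omega> \<partial>M)"
    by (intro Bochner_Integration.integral_cong) (auto simp: space_F)
  ultimately have "curve n x0 \<le> (\<integral>\<omega>. gap X \<tau> \<omega> \<partial>M)" using le by (simp add: prob_space)
  with \<tau> show ?thesis by blast
qed

end


section \<open>From exposure filtrations to the backward induction\<close>

lemma space_exposure [simp]: "space (exposure M N E i) = space M"
  by (simp add: exposure_def)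

lemma exposure_mono:
  assumes E: "\<And>j. j \<in> {1..n} \<Longrightarrow> E j \<in> measurable M (N j)" and "i \<le> k" "k \<le> n"
  shows "sets (exposure M N E i) \<subseteq> sets (exposure M N E k)"
  unfolding exposure_def[of M N E i]
proof (rule sets_image_in_sets)
  let ?e = "\<lambda>k \<omega>. \<lambda>j\<in>{1..k}. E j \<omega>"
  have "?e k \<in> measurable (exposure M N E k) (PiM {1..k} N)"
    unfolding exposure_def using E \<open>k \<le> n\<close>
    by (intro measurable_vimage_algebra1 Pi_I) (auto simp: space_PiM PiE_iff intro: measurable_space[OF E])
  moreover have "(\<lambda>f. restrict f {1..i}) \<in> measurable (PiM {1..k} N) (PiM {1..i} N)"
    using \<open>i \<le> k\<close> by (intro measurable_restrict_subset) auto
  ultimately have "(\<lambda>\<omega>. restrict (?e k \<omega>) {1..i}) \<in> measurable (exposure M N E k) (PiM {1..i} N)"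
    by (rule measurable_compose)
  moreover have "(\<lambda>\<omega>. restrict (?e k \<omega>) {1..i}) = ?e i"
    using \<open>i \<le> k\<close> by (auto simp: restrict_def fun_eq_iff)
  ultimately show "?e i \<in> measurable (exposure M N E k) (PiM {1..i} N)" by simp
qed simp

lemma subalgebra_exposure:
  assumes "\<And>j. j \<in> {1..i} \<Longrightarrow> E j \<in> measurable M (N j)"
  shows "subalgebra M (exposure M N E i)"
proof -
  have "sets (exposure M N E i) \<subseteq> sets M"
    unfolding exposure_def using assms by (intro sets_image_in_sets measurable_restrict) auto
  then show ?thesis by (simp add: subalgebra_def)
qed

lemma martingale_wrtD:
  assumes "martingale_wrt M N E n X"
  shows "\<And>i. i \<in> {1..n} \<Longrightarrow> E i \<in> measurable M (N i)"
    and "\<And>i. i \<le> n \<Longrightarrow> X i \<in> borel_measurable (exposure M N E i)"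
    and "\<And>i. i \<le> n \<Longrightarrow> integrable M (X i)"
    and "\<And>i. i < n \<Longrightarrow> AE \<omega> in M. real_cond_exp M (exposure M N E i) (X (Suc i)) \<omega> = X i \<omega>"
  using assms unfolding martingale_wrt_def by auto

text \<open>Clamping to \<open>[0,1]\<close> changes the martingale only on a null set.\<close>

lemma unit_martingale_clamp:
  assumes "prob_space M" and mart: "martingale_wrt M N E n X" and n: "n \<ge> 1"
    and range: "\<And>i. i \<le> n \<Longrightarrow> AE \<omega> in M. X i \<omega> \<in> {0..1}" and final: "AE \<omega> in M. X n \<omega> \<in> {0, 1}"
  shows "unit_martingale M (exposure M N E) (\<lambda>i \<omega>. max 0 (min 1 (X i \<omega>))) n"
proof -
  interpret prob_space M by fact
  note m = martingale_wrtD[OF mart]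
  have sub: "subalgebra M (exposure M N E i)" if "i \<le> n" for i
    using m(1) that by (intro subalgebra_exposure) auto
  show ?thesis
  proof (unfold_locales, goal_cases)
    case 1
    show ?case using n .
  next
    case (2 i)
    then show ?case by (rule sub)
  next
    case (3 i j)
    then show ?case by (intro exposure_mono[OF m(1)])
  next
    case (4 i)
    show ?case by simp
  next
    case (5 i)
    have [measurable]: "X i \<in> borel_measurable (exposure M N E i)" by (rule m(2)[OF 5])
    show ?case by measurable
  next
    case (6 i Z)
    then have i: "i \<le> n" "Suc i \<le> n" by auto
    let ?F = "exposure M N E i"
    have Z_M [measurable]: "Z \<in> borel_measurable M" by (rule measurable_from_subalg[OF sub[OF i(1)] 6(2)])
    have [measurable]: "X i \<in> borel_measurable M" "X (Suc i) \<in> borel_measurable M"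
      using m(3) i by blast+
    have clamp: "(\<integral>\<omega>. Z \<omega> * max 0 (min 1 (X j \<omega>)) \<partial>M) = (\<integral>\<omega>. Z \<omega> * X j \<omega> \<partial>M)" if "j \<le> n" for j
    proof (rule integral_cong_AE)
      have [measurable]: "X j \<in> borel_measurable M" using m(3) that by blast
      show "(\<lambda>\<omega>. Z \<omega> * max 0 (min 1 (X j \<omega>))) \<in> borel_measurable M" "(\<lambda>\<omega>. Z \<omega> * X j \<omega>) \<in> borel_measurable M"
        by measurable
      show "AE \<omega> in M. Z \<omega> * max 0 (min 1 (X j \<omega>)) = Z \<omega> * X j \<omega>"
        using range[OF that] by eventually_elim auto
    qed
    interpret sigma_finite_subalgebra M ?F
      by (intro finite_measure_subalgebra_is_sigma_finite finite_measure_subalgebra.intro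
          finite_measure_subalgebra_axioms.intro sub i finite_measure_axioms)
    have "integrable M (\<lambda>\<omega>. Z \<omega> * X (Suc i) \<omega>)"
    proof (rule integrable_const_bound[of _ 1])
      show "AE \<omega> in M. norm (Z \<omega> * X (Suc i) \<omega>) \<le> 1"
        using range[OF i(2)] AE_space
        by eventually_elim (use 6(3) in \<open>auto simp: abs_mult intro!: mult_le_one\<close>)
    qed measurable
    then have "(\<integral>\<omega>. Z \<omega> * X (Suc i) \<omega> \<partial>M) = (\<integral>\<omega>. Z \<omega> * real_cond_exp M ?F (X (Suc i)) \<omega> \<partial>M)"
      by (rule real_cond_exp_intg(2)[symmetric, OF _ 6(2)]) measurable
    also have "\<dots> = (\<integral>\<omega>. Z \<omega> * X i \<omega> \<partial>M)"
      using m(4)[OF 6(1)] by (intro integral_cong_AE) auto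
    finally show ?case using clamp i by simp
  next
    case (7 i \<omega>)
    show ?case by simp
  next
    case 8
    show ?case using final by eventually_elim auto
  qed
qed

lemma curve_le_sup_expected_gap:
  assumes P: "prob_space M" and mart: "martingale_wrt M N E n X" and n: "n \<ge> 1"
    and start: "\<And>\<omega>. \<omega> \<in> space M \<Longrightarrow> X 0 \<omega> = x0"
    and range: "\<And>i. i \<in> {1..n} \<Longrightarrow> AE \<omega> in M. X i \<omega> \<in> {0..1}" and final: "AE \<omega> in M. X n \<omega> \<in> {0, 1}"
  shows "curve n x0 \<le> (SUP \<tau>\<in>stopping_times M N E n. expected_gap M X \<tau>)"
proof -
  interpret prob_space M by fact
  note m = martingale_wrtD[OF mart]
  \<comment> \<open>The range assumption begins at index 1; the starting value lies in the interval
    because it is the mean of \<open>X 1\<close>.\<close>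
  have x0: "x0 \<in> {0..1}"
  proof -
    let ?F = "exposure M N E 0"
    interpret sigma_finite_subalgebra M ?F
      by (intro finite_measure_subalgebra_is_sigma_finite finite_measure_subalgebra.intro
          finite_measure_subalgebra_axioms.intro subalgebra_exposure finite_measure_axioms) auto
    have [measurable]: "X 0 \<in> borel_measurable M" using m(3)[of 0] by auto
    have "x0 = (\<integral>\<omega>. x0 \<partial>M)" by (simp add: prob_space)
    also have "\<dots> = (\<integral>\<omega>. X 0 \<omega> \<partial>M)" by (intro Bochner_Integration.integral_cong) (auto simp: start)
    also have "\<dots> = (\<integral>\<omega>. real_cond_exp M ?F (X (Suc 0)) \<omega> \<partial>M)"
      using m(4)[of 0] n by (intro integral_cong_AE) (auto elim: AE_mp)
    also have "\<dots> = (\<integral>\<omega>. X 1 \<omega> \<partial>M)" using m(3)[of 1] n by (simp add: real_cond_exp_int)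
    finally have eq: "x0 = (\<integral>\<omega>. X 1 \<omega> \<partial>M)" .
    have int: "integrable M (X 1)" using m(3)[of 1] n by simp
    have "AE \<omega> in M. X 1 \<omega> \<in> {0..1}" using range n by simp
    then have "AE \<omega> in M. 0 \<le> X 1 \<omega>" "AE \<omega> in M. X 1 \<omega> \<le> 1" by auto
    then show ?thesis
      using integral_ge_const[OF int, of 0] integral_le_const[OF int, of 1] eq by auto
  qed
  have range': "AE \<omega> in M. X i \<omega> \<in> {0..1}" if "i \<le> n" for i
    using range[of i] that start x0 by (cases "i = 0") (auto intro: AE_I2)
  have all: "AE \<omega> in M. \<forall>i\<in>{0..n}. X i \<omega> \<in> {0..1}"
    by (rule AE_finite_allI) (use range' in auto)
  have gap_le: "AE \<omega> in M. gap X \<tau> \<omega> \<le> 1" if "\<tau> \<in> stopping_times M N E n" for \<tau>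
    using all AE_space
  proof eventually_elim
    case (elim \<omega>)
    then have "\<tau> \<omega> \<in> {1..n}" using that by (auto simp: stopping_times_def)
    then have "X (\<tau> \<omega>) \<omega> \<in> {0..1}" "X (\<tau> \<omega> - 1) \<omega> \<in> {0..1}" using elim by auto
    then show ?case by auto
  qed
  \<comment> \<open>A real supremum dominates its members only when the family is bounded
    above.\<close>
  have bdd: "bdd_above (expected_gap M X ` stopping_times M N E n)"
  proof (rule bdd_aboveI2)
    fix \<tau> assume "\<tau> \<in> stopping_times M N E n"
    note * = gap_le[OF this]
    show "expected_gap M X \<tau> \<le> 1"
    proof (cases "integrable M (gap X \<tau>)")
      case True
      then show ?thesis using * unfolding expected_gap_def by (rule integral_le_const)
    next
      case False
      then show ?thesis unfolding expected_gap_def by (simp add: not_integrable_integral_eq)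
    qed
  qed
  define Y where "Y = (\<lambda>i \<omega>. max 0 (min 1 (X i \<omega>)))"
  interpret unit_martingale M "exposure M N E" Y n
    unfolding Y_def using P mart n range' final by (rule unit_martingale_clamp)
  have "Y 0 \<omega> = x0" if "\<omega> \<in> space M" for \<omega> using start[OF that] x0 by (auto simp: Y_def)
  then have "\<exists>\<tau>. stopping_time (exposure M N E) \<tau> \<and> (\<forall>\<omega>\<in>space M. \<tau> \<omega> \<in> {1..n}) \<and>
    curve n x0 \<le> (\<integral>\<omega>. gap Y \<tau> \<omega> \<partial>M)"
    by (rule exists_stopping_time)
  then obtain \<tau> where "stopping_time (exposure M N E) \<tau> \<and> (\<forall>\<omega>\<in>space M. \<tau> \<omega> \<in> {1..n}) \<and>
    curve n x0 \<le> (\<integral>\<omega>. gap Y \<tau> \<omega> \<partial>M)"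
    by (rule exE)
  then have \<tau>: "stopping_time (exposure M N E) \<tau>" "\<And>\<omega>. \<omega> \<in> space M \<Longrightarrow> \<tau> \<omega> \<in> {1..n}"
    "curve n x0 \<le> (\<integral>\<omega>. gap Y \<tau> \<omega> \<partial>M)"
    by auto
  \<comment> \<open>Needed to compare integrals of almost surely equal gaps. Each level set is a
    difference of two events of the form \<open>\<tau> \<le> t\<close>.\<close>
  have \<tau>_meas [measurable]: "\<tau> \<in> measurable M (count_space {1..n})"
    unfolding measurable_count_space_eq2[OF finite_atLeastAtMost]
  proof (intro conjI ballI Pi_I \<tau>(2))
    fix a assume a: "a \<in> {1..n}"
    have le_sets: "{\<omega> \<in> space M. \<tau> \<omega> \<le> t} \<in> sets M" if "t \<le> n" for t
    proof -
      have "Measurable.pred (exposure M N E t) (\<lambda>\<omega>. \<tau> \<omega> \<le> t)"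
        using \<tau>(1) unfolding stopping_time_def by (rule spec)
      then have "Measurable.pred M (\<lambda>\<omega>. \<tau> \<omega> \<le> t)"
        by (rule measurable_from_subalg[OF sub[OF that]])
      then show ?thesis by (rule predE)
    qed
    have "\<tau> -` {a} \<inter> space M = {\<omega> \<in> space M. \<tau> \<omega> \<le> a} - {\<omega> \<in> space M. \<tau> \<omega> \<le> a - 1}"
      using a by auto
    also have "\<dots> \<in> sets M" using a by (intro sets.Diff le_sets) auto
    finally show "\<tau> -` {a} \<inter> space M \<in> sets M" .
  qed
  have gap_meas: "gap Z \<tau> \<in> borel_measurable M" if Z: "\<And>i. i \<le> n \<Longrightarrow> Z i \<in> borel_measurable M" for Z
  proof (rule measurable_compose_countable'[OF _ \<tau>_meas])
    fix i assume "i \<in> {1..n}"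
    then have [measurable]: "Z i \<in> borel_measurable M" "Z (i - 1) \<in> borel_measurable M" using Z by auto
    show "(\<lambda>\<omega>. \<bar>Z i \<omega> - Z (i - 1) \<omega>\<bar>) \<in> borel_measurable M" by measurable
  qed simp
  have "(\<integral>\<omega>. gap Y \<tau> \<omega> \<partial>M) = expected_gap M X \<tau>"
    unfolding expected_gap_def
  proof (rule integral_cong_AE)
    show "AE \<omega> in M. gap Y \<tau> \<omega> = gap X \<tau> \<omega>"
      using all AE_space
    proof eventually_elim
      case (elim \<omega>)
      then have "\<tau> \<omega> \<in> {1..n}" using \<tau>(2) by auto
      then have "X (\<tau> \<omega>) \<omega> \<in> {0..1}" "X (\<tau> \<omega> - 1) \<omega> \<in> {0..1}" using elim by auto
      then show ?case by (simp add: Y_def)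
    qed
    show "gap X \<tau> \<in> borel_measurable M" using m(3) by (intro gap_meas) blast
    show "gap Y \<tau> \<in> borel_measurable M"
    proof (rule gap_meas)
      fix i assume "i \<le> n"
      then have [measurable]: "X i \<in> borel_measurable M" using m(3) by blast
      show "Y i \<in> borel_measurable M" unfolding Y_def by measurable
    qed
  qed
  moreover have "\<tau> \<in> stopping_times M N E n" using \<tau> by (auto simp: stopping_times_def)
  then have "expected_gap M X \<tau> \<le> (SUP \<tau>\<in>stopping_times M N E n. expected_gap M X \<tau>)"
    using bdd by (intro cSUP_upper)
  ultimately show ?thesis using \<tau>(3) by simp
qed

section \<open>The extremal walk on the cube\<close>

text \<open>\<open>m\<close> counts the moves left, the present one included. The last move must
  land in \<open>{0, 1}\<close>; any earlier one goes to a crossing point of the curve for the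
  \<open>m - 1\<close> moves that follow.\<close>

definition lower_child :: "nat \<Rightarrow> real \<Rightarrow> real" where
  "lower_child m x = (if m = 1 then 0 else lower_pt (curve (m - 1)) x)"

definition upper_child :: "nat \<Rightarrow> real \<Rightarrow> real" where
  "upper_child m x = (if m = 1 then 1 else upper_pt (curve (m - 1)) x)"

text \<open>If the two children coincide, this is \<open>0 / 0 = 0\<close>, and both children equal \<open>x\<close>.\<close>

definition up_prob :: "nat \<Rightarrow> real \<Rightarrow> real" where
  "up_prob m x = (x - lower_child m x) / (upper_child m x - lower_child m x)"

lemma children:
  assumes "m \<ge> 1" "0 \<le> x" "x \<le> 1"
  shows "0 \<le> lower_child m x" "lower_child m x \<le> x" "x \<le> upper_child m x" "upper_child m x \<le> 1"
  using assms lower_pt[of "curve (m - 1)" x] upper_pt[of "curve (m - 1)" x] tame_curve_curve[of "m - 1"]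
  by (auto simp: lower_child_def upper_child_def)

text \<open>This is the indifference built into the walk: the jump just made is exactly the value of
  the \<open>m\<close> moves still to come.\<close>

lemma children_on_curve:
  assumes "m \<ge> 1" "0 \<le> x" "x \<le> 1"
  shows "curve m (lower_child (Suc m) x) = x - lower_child (Suc m) x"
    and "curve m (upper_child (Suc m) x) = upper_child (Suc m) x - x"
  using assms lower_pt[of "curve m" x] upper_pt[of "curve m" x] tame_curve_curve[of m]
  by (auto simp: lower_child_def upper_child_def)

lemma up_prob_bounds:
  assumes "m \<ge> 1" "0 \<le> x" "x \<le> 1"
  shows "0 \<le> up_prob m x" "up_prob m x \<le> 1"
  using children[OF assms] by (auto simp: up_prob_def divide_le_eq_1)

lemma up_prob_mean:
  assumes "m \<ge> 1" "0 \<le> x" "x \<le> 1"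
  shows "up_prob m x * upper_child m x + (1 - up_prob m x) * lower_child m x = x"
proof (cases "upper_child m x = lower_child m x")
  case True
  then show ?thesis using children[OF assms] by (simp add: up_prob_def)
next
  case False
  then have "up_prob m x * (upper_child m x - lower_child m x) = x - lower_child m x"
    by (simp add: up_prob_def)
  then show ?thesis by (simp add: algebra_simps)
qed

text \<open>Up and down contribute equally, namely \<open>(x - l) * (u - x) / (u - l)\<close> each,
  and together they give the harmonic mean of the two distances. For the last move the distances are
  \<open>x\<close> and \<open>1 - x\<close>, which gives the parabola.\<close>

lemma up_prob_gap:
  assumes "m \<ge> 1" "0 \<le> x" "x \<le> 1"
  shows "up_prob m x * (upper_child m x - x) + (1 - up_prob m x) * (x - lower_child m x) = curve m x"
proof (cases "m = 1")
  case True
  then show ?thesis by (simp add: up_prob_def upper_child_def lower_child_def curve_1)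
next
  case False
  with assms have m: "m - 1 \<ge> 1" "m = Suc (m - 1)" by auto
  define l u where "l = lower_child m x" and "u = upper_child m x"
  have lu: "l \<le> x" "x \<le> u" using children[OF assms] by (auto simp: l_def u_def)
  have "curve m x = curve_transform (curve (m - 1)) x" using m curve_Suc by metis
  also have "\<dots> = harmonic_mean (x - l) (u - x)"
    using curve_transform_eq[OF tame_curve_curve[OF m(1)] assms(2,3)] False
    by (simp add: l_def u_def lower_child_def upper_child_def)
  also have "\<dots> = 2 * (x - l) * (u - x) / (u - l)" using lu by (simp add: harmonic_mean_eq)
  also have "\<dots> = up_prob m x * (u - x) + (1 - up_prob m x) * (x - l)"
  proof (cases "u = l")
    case True
    then show ?thesis using lu by simp
  next
    case False
    then have "1 - up_prob m x = (u - x) / (u - l)" by (simp add: up_prob_def l_def u_def field_simps)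
    then show ?thesis by (simp add: up_prob_def add_divide_distrib flip: l_def u_def)
  qed
  finally show ?thesis by (simp add: l_def u_def)
qed

section \<open>Paths as functions of bit strings\<close>

text \<open>After \<open>i\<close> moves there are \<open>n - i\<close> left, which selects the pair
  of children. Any bit other than 1 counts as down, so the function is total.\<close>

primrec position :: "nat \<Rightarrow> real \<Rightarrow> nat \<Rightarrow> (nat \<Rightarrow> nat) \<Rightarrow> real" where
  "position n x 0 w = x"
| "position n x (Suc i) w =
     (if w (Suc i) = 1 then upper_child (n - i) (position n x i w)
      else lower_child (n - i) (position n x i w))"

text \<open>The bias of the next bit depends on the present position, so the bits need not be
  independent.\<close>

primrec path_prob :: "nat \<Rightarrow> real \<Rightarrow> nat \<Rightarrow> (nat \<Rightarrow> nat) \<Rightarrow> real" where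
  "path_prob n x 0 w = 1"
| "path_prob n x (Suc i) w = path_prob n x i w *
     (if w (Suc i) = 1 then up_prob (n - i) (position n x i w)
      else 1 - up_prob (n - i) (position n x i w))"

text \<open>The combinatorial counterpart of measurability at time \<open>i\<close>;
  \<open>exposure_depends\<close> and \<open>measurable_depends\<close> translate between the
  two.\<close>

definition depends_on_first :: "nat \<Rightarrow> ((nat \<Rightarrow> nat) \<Rightarrow> 'b) \<Rightarrow> bool" where
  "depends_on_first i Z \<longleftrightarrow> (\<forall>w w'. (\<forall>j\<in>{1..i}. w j = w' j) \<longrightarrow> Z w = Z w')"

lemma depends_on_firstD: "depends_on_first i Z \<Longrightarrow> (\<And>j. j \<in> {1..i} \<Longrightarrow> w j = w' j) \<Longrightarrow> Z w = Z w'"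
  by (simp add: depends_on_first_def)

lemma depends_on_first_upd:
  fixes Z :: "(nat \<Rightarrow> nat) \<Rightarrow> _"
  shows "depends_on_first i Z \<Longrightarrow> i < j \<Longrightarrow> Z (w(j := c)) = Z w"
  by (erule depends_on_firstD) auto

lemma depends_on_first_mono: "depends_on_first i Z \<Longrightarrow> i \<le> j \<Longrightarrow> depends_on_first j Z"
  by (auto simp: depends_on_first_def)

lemma depends_on_first_mult:
  "depends_on_first i Z \<Longrightarrow> depends_on_first i W \<Longrightarrow> depends_on_first i (\<lambda>w. Z w * W w)"
  unfolding depends_on_first_def by metis

lemma depends_on_first_position: "depends_on_first i (position n x i)"
proof (induction i)
  case (Suc i)
  show ?case
    unfolding depends_on_first_def
  proof (intro allI impI)
    fix w w' :: "nat \<Rightarrow> nat" assume *: "\<forall>j\<in>{1..Suc i}. w j = w' j"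
    then have "position n x i w = position n x i w'"
      by (intro depends_on_firstD[OF Suc]) auto
    then show "position n x (Suc i) w = position n x (Suc i) w'" using * by simp
  qed
qed (simp add: depends_on_first_def)

lemma depends_on_first_path_prob: "depends_on_first i (path_prob n x i)"
proof (induction i)
  case (Suc i)
  show ?case
    unfolding depends_on_first_def
  proof (intro allI impI)
    fix w w' :: "nat \<Rightarrow> nat" assume *: "\<forall>j\<in>{1..Suc i}. w j = w' j"
    then have "path_prob n x i w = path_prob n x i w'" "position n x i w = position n x i w'"
      by (auto intro!: depends_on_firstD[OF Suc] depends_on_firstD[OF depends_on_first_position])
    then show "path_prob n x (Suc i) w = path_prob n x (Suc i) w'" using * by simp
  qed
qed (simp add: depends_on_first_def)

definition cube :: "nat \<Rightarrow> (nat \<Rightarrow> nat) set" where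
  "cube k = {1..k} \<rightarrow>\<^sub>E {0, 1}"

lemma finite_cube [simp]: "finite (cube k)"
  unfolding cube_def by (intro finite_PiE) auto

lemma sum_cube_Suc:
  fixes g :: "(nat \<Rightarrow> nat) \<Rightarrow> real"
  shows "(\<Sum>w\<in>cube (Suc k). g w) = (\<Sum>w\<in>cube k. g (w(Suc k := 1)) + g (w(Suc k := 0)))"
proof -
  have "cube (Suc k) = (\<lambda>(y, w). w(Suc k := y)) ` ({0, 1} \<times> cube k)"
    by (simp add: cube_def atLeastAtMostSuc_conv PiE_insert_eq)
  moreover have "inj_on (\<lambda>(y, w). w(Suc k := y)) ({0, 1} \<times> cube k)"
    unfolding cube_def by (rule inj_combinator) simp
  ultimately have "(\<Sum>w\<in>cube (Suc k). g w) = (\<Sum>(y, w)\<in>{0, 1} \<times> cube k. g (w(Suc k := y)))"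
    by (simp add: sum.reindex case_prod_unfold)
  also have "\<dots> = (\<Sum>y\<in>{0, 1}. \<Sum>w\<in>cube k. g (w(Suc k := y)))"
    by (rule sum.cartesian_product[symmetric])
  finally show ?thesis by (simp add: sum.distrib)
qed

locale extremal_walk =
  fixes n :: nat and x0 :: real
  assumes n_pos: "n \<ge> 1" and x0: "0 \<le> x0" "x0 \<le> 1"
begin

abbreviation "X \<equiv> position n x0"

abbreviation "up i w \<equiv> up_prob (n - i) (X i w)"

text \<open>Expectation over the first \<open>k\<close> bits. Leaving \<open>k\<close> variable
  allows bits to be peeled off one at a time.\<close>

definition E :: "nat \<Rightarrow> ((nat \<Rightarrow> nat) \<Rightarrow> real) \<Rightarrow> real" where
  "E k Z = (\<Sum>w\<in>cube k. path_prob n x0 k w * Z w)"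

lemma position_bounds: "i \<le> n \<Longrightarrow> 0 \<le> X i w \<and> X i w \<le> 1"
proof (induction i)
  case 0
  show ?case using x0 by simp
next
  case (Suc i)
  then have "n - i \<ge> 1" "0 \<le> X i w" "X i w \<le> 1" by auto
  from children[OF this] show ?case by auto
qed

lemma position_upd: "i < j \<Longrightarrow> X i (w(j := c)) = X i w"
  using depends_on_first_upd[OF depends_on_first_position] .

lemma path_prob_nonneg: "k \<le> n \<Longrightarrow> 0 \<le> path_prob n x0 k w"
proof (induction k)
  case (Suc k)
  then have "n - k \<ge> 1" "0 \<le> X k w" "X k w \<le> 1" using position_bounds[of k w] by auto
  from up_prob_bounds[OF this] Suc show ?case by auto
qed simp

lemma E_Suc:
  "E (Suc k) Z = E k (\<lambda>w. up k w * Z (w(Suc k := 1)) + (1 - up k w) * Z (w(Suc k := 0)))"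
  unfolding E_def sum_cube_Suc
  by (intro sum.cong)
    (simp_all add: position_upd depends_on_first_upd[OF depends_on_first_path_prob] algebra_simps)

text \<open>The two transition weights add up to 1, so averaging over a later bit changes
  nothing.\<close>

lemma E_first:
  assumes "depends_on_first k Z" "k \<le> j"
  shows "E j Z = E k Z"
  using assms(2)
proof (induction rule: dec_induct)
  case (step j)
  have "Z (w(Suc j := c)) = Z w" for w c
    using depends_on_first_upd[OF assms(1)] step by simp
  then have "E (Suc j) Z = E j Z" by (simp add: E_Suc algebra_simps)
  with step show ?case by simp
qed simp

lemma E_const: "E k (\<lambda>_. c) = c"
proof -
  have "E k (\<lambda>_. c) = E 0 (\<lambda>_. c)" by (rule E_first) (auto simp: depends_on_first_def)
  then show ?thesis by (simp add: E_def cube_def)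
qed

text \<open>Averaging over bit \<open>Suc i\<close> replaces \<open>Z\<close> by its one-step mean
  \<open>V\<close>, while \<open>W\<close> is unaffected. It serves both the positions and the jump
  sizes.\<close>

lemma E_martingale:
  assumes "i < n" and W: "depends_on_first i W" and Z: "depends_on_first (Suc i) Z" and V: "depends_on_first i V"
    and mean: "\<And>w. up i w * Z (w(Suc i := 1)) + (1 - up i w) * Z (w(Suc i := 0)) = V w"
  shows "E n (\<lambda>w. W w * Z w) = E n (\<lambda>w. W w * V w)"
proof -
  have "E n (\<lambda>w. W w * Z w) = E (Suc i) (\<lambda>w. W w * Z w)"
    using \<open>i < n\<close> by (intro E_first depends_on_first_mult Z depends_on_first_mono[OF W]) auto
  also have "\<dots> = E i (\<lambda>w. W w * (up i w * Z (w(Suc i := 1)) + (1 - up i w) * Z (w(Suc i := 0))))"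
    by (simp add: E_Suc depends_on_first_upd[OF W] algebra_simps)
  also have "\<dots> = E i (\<lambda>w. W w * V w)" by (simp only: mean)
  also have "\<dots> = E n (\<lambda>w. W w * V w)"
    using \<open>i < n\<close> by (intro E_first[symmetric] depends_on_first_mult W V) auto
  finally show ?thesis .
qed

lemma position_mean:
  assumes "i < n"
  shows "up i w * X (Suc i) (w(Suc i := 1)) + (1 - up i w) * X (Suc i) (w(Suc i := 0)) = X i w"
  using assms position_bounds[of i w] up_prob_mean[of "n - i" "X i w"] by (simp add: position_upd)

text \<open>The size of the jump at time \<open>i < n\<close> is \<open>curve (n - i) (X i)\<close>, whichever branch is taken.\<close>

definition jump :: "nat \<Rightarrow> (nat \<Rightarrow> nat) \<Rightarrow> real" where
  "jump i w = (if i < n then curve (n - i) (X i w) else \<bar>X i w - X (i - 1) w\<bar>)"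

lemma jump_eq:
  assumes "i \<in> {1..n}"
  shows "\<bar>X i w - X (i - 1) w\<bar> = jump i w"
proof (cases "i < n")
  case True
  obtain k where k: "i = Suc k" using assms by (cases i) auto
  \<comment> \<open>Move \<open>i\<close> starts with one move more than the \<open>n - i\<close>
    that follow it, so its targets lie on the curve of index \<open>n - i\<close>.\<close>
  have m: "n - k = Suc (n - i)" "n - i \<ge> 1" using True k by auto
  have b: "0 \<le> X k w" "X k w \<le> 1" using position_bounds[of k w] True k by auto
  from children_on_curve[OF m(2) b] children[of "n - k" "X k w"] b m True show ?thesis
    by (auto simp: jump_def k simp del: One_nat_def)
qed (simp add: jump_def)

lemma depends_on_first_jump: "depends_on_first i (jump i)"
  unfolding depends_on_first_def
proof (intro allI impI)
  fix w w' :: "nat \<Rightarrow> nat" assume "\<forall>j\<in>{1..i}. w j = w' j"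
  then have "X i w = X i w'" "X (i - 1) w = X (i - 1) w'"
    by (auto intro!: depends_on_firstD[OF depends_on_first_position])
  then show "jump i w = jump i w'" by (simp add: jump_def)
qed

lemma jump_mean:
  assumes "i < n"
  shows "up i w * jump (Suc i) (w(Suc i := 1)) + (1 - up i w) * jump (Suc i) (w(Suc i := 0)) = jump i w"
proof -
  have m: "n - i \<ge> 1" using assms by simp
  have b: "0 \<le> X i w" "X i w \<le> 1" using position_bounds[of i w] assms by auto
  have "jump (Suc i) (w(Suc i := c)) = \<bar>X (Suc i) (w(Suc i := c)) - X i w\<bar>" for c
    using jump_eq[of "Suc i" "w(Suc i := c)"] assms by (simp add: position_upd del: position.simps)
  then show ?thesis
    using up_prob_gap[OF m b] children[OF m b] assms by (simp add: position_upd jump_def)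
qed

text \<open>Optional stopping by telescoping: \<open>jump\<close> at the stopping time is
  \<open>jump 0\<close> plus the increments over all \<open>i\<close> before it, and each increment
  has mean 0 against a function of the first \<open>i\<close> bits. \<open>W\<close> is only
  required to match on the cube, outside of which \<tau> is arbitrary.\<close>

lemma E_stopped:
  assumes \<tau>: "\<And>w. w \<in> cube n \<Longrightarrow> \<tau> w \<in> {1..n}"
    and stop: "\<And>i. i < n \<Longrightarrow> \<exists>W. depends_on_first i W \<and> (\<forall>w\<in>cube n. W w = (of_bool (i < \<tau> w) :: real))"
  shows "E n (\<lambda>w. jump (\<tau> w) w) = curve n x0"
proof -
  obtain W where W: "\<And>i. i < n \<Longrightarrow> depends_on_first i (W i)"
      "\<And>i w. i < n \<Longrightarrow> w \<in> cube n \<Longrightarrow> W i w = (of_bool (i < \<tau> w) :: real)"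
    using stop by metis
  have "E n (\<lambda>w. jump (\<tau> w) w) = E n (\<lambda>w. curve n x0 + (\<Sum>i<n. W i w * jump (Suc i) w - W i w * jump i w))"
    unfolding E_def
  proof (intro sum.cong refl arg_cong2[of _ _ _ _ "(*)"])
    fix w assume w: "w \<in> cube n"
    have "(\<Sum>i<n. W i w * jump (Suc i) w - W i w * jump i w)
        = (\<Sum>i<n. if i < \<tau> w then jump (Suc i) w - jump i w else 0)"
      by (intro sum.cong) (auto simp: W(2)[OF _ w])
    also have "\<dots> = (\<Sum>i<\<tau> w. jump (Suc i) w - jump i w)"
      using \<tau>[OF w] by (intro sum.mono_neutral_cong_right) auto
    also have "\<dots> = jump (\<tau> w) w - jump 0 w" by (rule sum_lessThan_telescope)
    \<comment> \<open>No move precedes time 0; \<open>jump 0\<close> is the value that extends the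
      jump sizes to a martingale started there.\<close>
    also have "jump 0 w = curve n x0" using n_pos by (simp add: jump_def)
    finally show "jump (\<tau> w) w = curve n x0 + (\<Sum>i<n. W i w * jump (Suc i) w - W i w * jump i w)" by simp
  qed
  also have "\<dots> = E n (\<lambda>_. curve n x0) + (\<Sum>i<n. E n (\<lambda>w. W i w * jump (Suc i) w) - E n (\<lambda>w. W i w * jump i w))"
    unfolding E_def
    by (simp add: distrib_left sum.distrib sum_distrib_left right_diff_distrib sum_subtractf
        sum.swap[of _ "{..<n}" "cube n"])
  also have "\<dots> = curve n x0"
    using E_martingale[OF _ W(1) depends_on_first_jump depends_on_first_jump jump_mean] by (simp add: E_const)
  finally show ?thesis .
qed

section \<open>The walk as a martingale on the cube\<close>

definition M :: "(nat \<Rightarrow> nat) measure" where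
  "M = point_measure (cube n) (\<lambda>w. ennreal (path_prob n x0 n w))"

abbreviation "F \<equiv> exposure M (\<lambda>_. count_space {0, 1}) (\<lambda>i w. w i)"

lemma space_M: "space M = cube n" and sets_M: "sets M = Pow (cube n)"
  by (simp_all add: M_def space_point_measure sets_point_measure)

lemma integral_M:
  fixes g :: "(nat \<Rightarrow> nat) \<Rightarrow> real"
  shows "(\<integral>w. g w \<partial>M) = E n g"
  unfolding M_def E_def by (simp add: lebesgue_integral_point_measure_finite path_prob_nonneg)

lemma integrable_M:
  fixes g :: "(nat \<Rightarrow> nat) \<Rightarrow> real"
  shows "integrable M g"
  unfolding M_def by (intro integrable_point_measure_finite) auto

lemma prob_space_M: "prob_space M"
proof
  have "emeasure M (space M) = (\<Sum>w\<in>cube n. ennreal (path_prob n x0 n w))"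
    by (simp add: space_M) (simp add: M_def emeasure_point_measure_finite)
  also have "\<dots> = ennreal (E n (\<lambda>_. 1))"
    by (simp add: E_def path_prob_nonneg sum_ennreal)
  finally show "emeasure M (space M) = 1" by (simp add: E_const)
qed

text \<open>\<open>B\<close> is the trace on the cube of a preimage under truncation to
  \<open>i\<close> bits; the untraced preimage supplies \<open>W\<close>, defined on all bit
  sequences.\<close>

lemma exposure_depends:
  assumes "i \<le> n" and B: "B \<in> sets (F i)"
  obtains W where "depends_on_first i W" "\<And>w. w \<in> cube n \<Longrightarrow> W w = (indicator B w :: real)"
proof -
  let ?r = "\<lambda>w. \<lambda>j\<in>{1..i}. w j :: nat"
  have "?r \<in> cube n \<rightarrow> space (PiM {1..i} (\<lambda>_. count_space {0, 1}))"
    using \<open>i \<le> n\<close> by (auto simp: cube_def space_PiM PiE_iff)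
  then obtain A where A: "B = ?r -` A \<inter> cube n"
    using B by (auto simp: exposure_def space_M sets_vimage_algebra2)
  show thesis
  proof
    show "depends_on_first i (\<lambda>w. indicator A (?r w) :: real)"
      by (auto simp: depends_on_first_def intro!: arg_cong[of _ _ "indicator A"] restrict_ext)
    show "indicator A (?r w) = (indicator B w :: real)" if "w \<in> cube n" for w
      using that by (simp add: A indicator_def)
  qed
qed

text \<open>\<open>Z\<close> factors through truncation to \<open>i\<close> bits, whose target, a
  finite product of finite discrete spaces, is discrete.\<close>

lemma measurable_depends:
  fixes Z :: "(nat \<Rightarrow> nat) \<Rightarrow> real"
  assumes "i \<le> n" and Z: "depends_on_first i Z"
  shows "Z \<in> borel_measurable (F i)"
proof -
  let ?r = "\<lambda>w. \<lambda>j\<in>{1..i}. w j :: nat"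
  have P: "PiM {1..i} (\<lambda>_. count_space {0, 1::nat}) = count_space (cube i)"
    unfolding cube_def by (rule count_space_PiM_finite) auto
  have "?r \<in> cube n \<rightarrow> space (PiM {1..i} (\<lambda>_. count_space {0, 1}))"
    using \<open>i \<le> n\<close> by (auto simp: cube_def space_PiM PiE_iff)
  then have "?r \<in> measurable (F i) (PiM {1..i} (\<lambda>_. count_space {0, 1}))"
    unfolding exposure_def space_M by (rule measurable_vimage_algebra1)
  then have "(\<lambda>w. Z (?r w)) \<in> borel_measurable (F i)"
    unfolding P by (rule measurable_compose) simp
  moreover have "Z (?r w) = Z w" for w by (rule depends_on_firstD[OF Z]) simp
  ultimately show ?thesis by simp
qed

lemma martingale_wrt_position: "martingale_wrt M (\<lambda>_. count_space {0, 1}) (\<lambda>i w. w i) n X"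
  unfolding martingale_wrt_def
proof (intro conjI ballI integrable_M)
  have coord: "(\<lambda>w. w i) \<in> measurable M (count_space {0, 1})" if "i \<in> {1..n}" for i
    using that by (auto simp: M_def cube_def PiE_iff)
  then show "(\<lambda>w. w i) \<in> measurable M (count_space {0, 1})" if "i \<in> {1..n}" for i using that .
  show "X i \<in> borel_measurable (F i)" if "i \<in> {0..n}" for i
    using that by (intro measurable_depends depends_on_first_position) auto
  fix i assume i: "i \<in> {0..<n}"
  interpret prob_space M by (rule prob_space_M)
  interpret sigma_finite_subalgebra M "F i"
    using i by (intro finite_measure_subalgebra_is_sigma_finite finite_measure_subalgebra.intro
          finite_measure_subalgebra_axioms.intro subalgebra_exposure finite_measure_axioms coord) auto
  show "AE w in M. real_cond_exp M (F i) (X (Suc i)) w = X i w"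
  proof (rule real_cond_exp_charact[OF _ integrable_M integrable_M])
    show "X i \<in> borel_measurable (F i)"
      using i by (intro measurable_depends depends_on_first_position) auto
    fix B assume "B \<in> sets (F i)"
    then obtain W where W: "depends_on_first i W" "\<And>w. w \<in> cube n \<Longrightarrow> W w = (indicator B w :: real)"
      using exposure_depends[of i B] i by auto
    \<comment> \<open>Integrating over an event of \<open>F i\<close> is weighting by a function of
      the first \<open>i\<close> bits, the form in which \<open>E_martingale\<close>
      applies.\<close>
    have W_int: "(LINT w:B|M. Z w) = E n (\<lambda>w. W w * Z w)" for Z :: "(nat \<Rightarrow> nat) \<Rightarrow> real"
      unfolding set_lebesgue_integral_def integral_M E_def by (intro sum.cong) (auto simp: W(2))
    show "(LINT w:B|M. X (Suc i) w) = (LINT w:B|M. X i w)"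
      unfolding W_int using i
      by (intro E_martingale[OF _ W(1) depends_on_first_position depends_on_first_position position_mean]) auto
  qed
qed

lemma expected_gap_eq:
  assumes \<tau>: "\<tau> \<in> stopping_times M (\<lambda>_. count_space {0, 1}) (\<lambda>i w. w i) n"
  shows "expected_gap M X \<tau> = curve n x0"
proof -
  have range: "\<tau> w \<in> {1..n}" if "w \<in> cube n" for w
    using \<tau> that by (simp add: stopping_times_def space_M)
  have "expected_gap M X \<tau> = E n (\<lambda>w. jump (\<tau> w) w)"
    unfolding expected_gap_def integral_M E_def using range
    by (intro sum.cong refl arg_cong2[of _ _ _ _ "(*)"] jump_eq)
  also have "\<dots> = curve n x0"
  proof (rule E_stopped[OF range])
    fix i assume "i < n"
    have "Measurable.pred (F i) (\<lambda>w. \<tau> w \<le> i)"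
      using \<tau> by (simp add: stopping_times_def stopping_time_def)
    then have "{w \<in> space (F i). \<not> \<tau> w \<le> i} \<in> sets (F i)" by measurable
    moreover define B where "B = {w \<in> space (F i). \<not> \<tau> w \<le> i}"
    ultimately obtain W where "depends_on_first i W" "\<And>w. w \<in> cube n \<Longrightarrow> W w = (indicator B w :: real)"
      using exposure_depends[of i B] \<open>i < n\<close> by auto
    moreover have "indicator B w = (of_bool (i < \<tau> w) :: real)" if "w \<in> cube n" for w
      using that by (simp add: B_def space_M indicator_def not_le)
    ultimately show "\<exists>W. depends_on_first i W \<and> (\<forall>w\<in>cube n. W w = (of_bool (i < \<tau> w) :: real))"
      by (intro exI[of _ W]) simp
  qed
  finally show ?thesis .
qed

lemma final_position: "X n w \<in> {0, 1}"
proof -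
  obtain k where k: "n = Suc k" using n_pos by (cases n) auto
  then have "n - k = 1" by simp
  then have "X (Suc k) w \<in> {0, 1}" by (simp add: upper_child_def lower_child_def)
  then show ?thesis by (simp only: k[symmetric])
qed

end

theorem theorem1:
  fixes n :: nat
  assumes "n \<ge> 1"
  shows
    "(\<forall>(M :: 'a measure) (N :: nat \<Rightarrow> 'e measure) E X (x0 :: real).
        prob_space M \<longrightarrow>
        martingale_wrt M N E n X \<longrightarrow>
        (\<forall>\<omega>\<in>space M. X 0 \<omega> = x0) \<longrightarrow>
        (\<forall>i\<in>{1..n}. AE \<omega> in M. X i \<omega> \<in> {0..1}) \<longrightarrow>
        (AE \<omega> in M. X n \<omega> \<in> {0, 1}) \<longrightarrow>
        (SUP \<tau>\<in>stopping_times M N E n. expected_gap M X \<tau>) \<ge> curve n x0) \<and>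
     (\<forall>x0\<in>{0..1}. \<exists>(M :: (nat \<Rightarrow> nat) measure) X.
        prob_space M \<and>
        space M = {1..n} \<rightarrow>\<^sub>E {0, 1} \<and> sets M = Pow (space M) \<and>
        martingale_wrt M (\<lambda>_. count_space {0, 1}) (\<lambda>i \<omega>. \<omega> i) n X \<and>
        (\<forall>\<omega>\<in>space M. X 0 \<omega> = x0) \<and>
        (\<forall>i\<in>{1..n}. \<forall>\<omega>\<in>space M. X i \<omega> \<in> {0..1}) \<and>
        (\<forall>\<omega>\<in>space M. X n \<omega> \<in> {0, 1}) \<and>
        (\<forall>\<tau>\<in>stopping_times M (\<lambda>_. count_space {0, 1}) (\<lambda>i \<omega>. \<omega> i) n.
           expected_gap M X \<tau> = curve n x0))"
proof (intro conjI allI impI ballI)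
  fix M :: "'a measure" and N :: "nat \<Rightarrow> 'e measure" and E X and x0 :: real
  assume "prob_space M" "martingale_wrt M N E n X" "\<forall>\<omega>\<in>space M. X 0 \<omega> = x0"
    "\<forall>i\<in>{1..n}. AE \<omega> in M. X i \<omega> \<in> {0..1}" "AE \<omega> in M. X n \<omega> \<in> {0, 1}"
  then show "curve n x0 \<le> (SUP \<tau>\<in>stopping_times M N E n. expected_gap M X \<tau>)"
    using assms by (intro curve_le_sup_expected_gap) blast+
next
  fix x0 :: real assume "x0 \<in> {0..1}"
  with assms interpret extremal_walk n x0 by unfold_locales auto
  show "\<exists>(M :: (nat \<Rightarrow> nat) measure) X.
        prob_space M \<and>
        space M = {1..n} \<rightarrow>\<^sub>E {0, 1} \<and> sets M = Pow (space M) \<and>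
        martingale_wrt M (\<lambda>_. count_space {0, 1}) (\<lambda>i \<omega>. \<omega> i) n X \<and>
        (\<forall>\<omega>\<in>space M. X 0 \<omega> = x0) \<and>
        (\<forall>i\<in>{1..n}. \<forall>\<omega>\<in>space M. X i \<omega> \<in> {0..1}) \<and>
        (\<forall>\<omega>\<in>space M. X n \<omega> \<in> {0, 1}) \<and>
        (\<forall>\<tau>\<in>stopping_times M (\<lambda>_. count_space {0, 1}) (\<lambda>i \<omega>. \<omega> i) n.
           expected_gap M X \<tau> = curve n x0)"
  proof (intro exI[of _ M] exI[of _ X] conjI ballI)
    show "prob_space M" by (rule prob_space_M)
    show "space M = {1..n} \<rightarrow>\<^sub>E {0, 1}" by (simp only: space_M cube_def)
    show "sets M = Pow (space M)" by (simp only: space_M sets_M)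
    show "martingale_wrt M (\<lambda>_. count_space {0, 1}) (\<lambda>i \<omega>. \<omega> i) n X" by (rule martingale_wrt_position)
    show "X 0 \<omega> = x0" for \<omega> by simp
    show "X i \<omega> \<in> {0..1}" if "i \<in> {1..n}" for i \<omega> using position_bounds[of i \<omega>] that by simp
    show "X n \<omega> \<in> {0, 1}" for \<omega> by (rule final_position)
    show "expected_gap M X \<tau> = curve n x0"
      if "\<tau> \<in> stopping_times M (\<lambda>_. count_space {0, 1}) (\<lambda>i \<omega>. \<omega> i) n" for \<tau>
      using that by (rule expected_gap_eq)
  qed
qed

end
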